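(* Let $\mathbb B=(\{0,1\},+,\cdot)$ be the idempotent semifield with $1+1=1$. (i) Let $E$ be a $\mathbb B$-semimodule. Then $E$ is selective if and only if $\underline{\mathrm{rk}}(E)=1$. (ii) There exists a unique, up to canonical isomorphism, $\mathbb B$-semimodule $E=\mathbb B^{(n,1)}$ such that $\mathrm{rk}(E)=n$ and $\underline{\mathrm{rk}}(E)=1$ ($n\ge1$). One has $\mathbb B^{(n,1)}=X^\vee$, for $X=\{1,\dots,n\}$ as a totally ordered set. (iii) The following properties hold for the semimodules $\mathbb B^{(n,1)}$: (a) $\mathbb B^{(n,1)}$ is of minimal cardinality among the $\mathbb B$-semimodules of rank $n$. (b) $\mathbb B^{(n,1)}$ is a projective semimodule over $\mathbb B$, equal to the range of a projection matrix $P\in M_n(\mathbb B)$, $P^2=P$. (c) The semiring of endomorphisms $\mathrm{End}_{\mathbb B}(\mathbb B^{(n,1)})$ is isomorphic to $PM_n(\mathbb B)P$. (iv) The simplicial category $\Delta$ is canonically isomorphic to the full subcategory $\mathcal P_{\mathbb B}\subset\mathbb P_{\mathbb B}$ whose objects are the semimodules $\mathbb B^{(n,1)}$ and whose morphisms are the (projective classes of) linear maps $f$ such that $f^{-1}(\{0\})=\{0\}$.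
   Context: A semifield is a commutative semiring whose non-zero elements form a group under multiplication. A semimodule over a semifield $K$ is a commutative monoid $(E,+)$ with identity $0$ and a $K$-action with $\lambda(x+y)=\lambda x+\lambda y$, $(\lambda+\mu)x=\lambda x+\mu x$, $(\lambda\mu)x=\lambda(\mu x)$, $0x=0$, $1x=x$. A commutative monoid $E$ is selective if $x+y\in\{x,y\}$ for all $x,y\in E$. For a (finitely generated) semimodule $E$ over $K$, the rank $\mathrm{rk}(E)$ is the smallest integer $n$ such that $E$ has a set of generators of cardinality $n$; the free rank $\underline{\mathrm{rk}}(E)$ is the largest integer $n$ such that there exists a free subsemimodule of $E$ of rank $n$. For a semi-lattice $X$ (poset with binary joins), $X^\vee=X\cup\{0\}$ is the $\mathbb B$-semimodule with addition $x\vee y=\mathrm{join}(x,y)$ for $x,y\in X$ and $0\vee x=x\vee0=x$ for $x\in X^\vee$. $\mathbb P_{\mathbb B}$ is the category whose objects are the semimodules over $\mathbb B$ and whose morphisms $E_1\to E_2$ are projective classes of additive maps $f:E_1\to E_2$ with $f^{-1}(\{0\})=\{0\}$ that are semilinear, i.e. $f(\lambda x)=\sigma(\lambda)f(x)$ for a semifield endomorphism $\sigma$ of $\mathbb B$; since $\mathbb B$ has no non-trivial endomorphism, semilinear means linear. Two maps are in the same projective class if they differ by multiplication by a non-zero scalar (here $\mathbb B^\times=\{1\}$, so projective classes are single maps). $\Delta$ is the category with objects $[n]=\{0,\dots,n\}$, $n\ge0$, and non-decreasing maps as morphisms.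
   Formalization: In (i), E is additionally required to be non-zero for "selective implies free rank 1": the zero semimodule E = {0} is selective, but its free rank is 0, so the equivalence fails for it as stated. *)

theory Defs
  imports
    "HOL-Algebra.QuotRing"
    "HOL-Algebra.Lattice"
    "HOL-Algebra.Module"
    "HOL-Library.Extended_Nat"
    "HOL-Library.Equipollence"
    "Jordan_Normal_Form.Matrix"
begin

section \<open>Semifields and semimodules\<close>

definition semifield :: "('k, 'r) ring_scheme \<Rightarrow> bool" where
  "semifield K \<longleftrightarrow> semiring K \<and> comm_monoid K \<and>
     group \<lparr>carrier = carrier K - {\<zero>\<^bsub>K\<^esub>}, monoid.mult = monoid.mult K, one = \<one>\<^bsub>K\<^esub>\<rparr>"

text \<open>As for the library's modules, the fields \<open>mult\<close> and \<open>one\<close> of the record \<open>E\<close> are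
  irrelevant.\<close>

definition semimodule :: "('k, 'r) ring_scheme \<Rightarrow> ('k, 'e, 'z) module_scheme \<Rightarrow> bool" where
  "semimodule K E \<longleftrightarrow> semifield K \<and> abelian_monoid E \<and>
     (\<forall>a\<in>carrier K. \<forall>x\<in>carrier E. a \<odot>\<^bsub>E\<^esub> x \<in> carrier E) \<and>
     (\<forall>a\<in>carrier K. \<forall>x\<in>carrier E. \<forall>y\<in>carrier E.
        a \<odot>\<^bsub>E\<^esub> (x \<oplus>\<^bsub>E\<^esub> y) = a \<odot>\<^bsub>E\<^esub> x \<oplus>\<^bsub>E\<^esub> a \<odot>\<^bsub>E\<^esub> y) \<and>
     (\<forall>a\<in>carrier K. \<forall>b\<in>carrier K. \<forall>x\<in>carrier E.
        (a \<oplus>\<^bsub>K\<^esub> b) \<odot>\<^bsub>E\<^esub> x = a \<odot>\<^bsub>E\<^esub> x \<oplus>\<^bsub>E\<^esub> b \<odot>\<^bsub>E\<^esub> x) \<and>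
     (\<forall>a\<in>carrier K. \<forall>b\<in>carrier K. \<forall>x\<in>carrier E.
        (a \<otimes>\<^bsub>K\<^esub> b) \<odot>\<^bsub>E\<^esub> x = a \<odot>\<^bsub>E\<^esub> (b \<odot>\<^bsub>E\<^esub> x)) \<and>
     (\<forall>x\<in>carrier E. \<zero>\<^bsub>K\<^esub> \<odot>\<^bsub>E\<^esub> x = \<zero>\<^bsub>E\<^esub>) \<and>
     (\<forall>x\<in>carrier E. \<one>\<^bsub>K\<^esub> \<odot>\<^bsub>E\<^esub> x = x)"

definition selective :: "('e, 'z) ring_scheme \<Rightarrow> bool" where
  "selective E \<longleftrightarrow> abelian_monoid E \<and>
     (\<forall>x\<in>carrier E. \<forall>y\<in>carrier E. x \<oplus>\<^bsub>E\<^esub> y \<in> {x, y})"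

definition subsemimodule ::
    "('k, 'r) ring_scheme \<Rightarrow> 'e set \<Rightarrow> ('k, 'e, 'z) module_scheme \<Rightarrow> bool" where
  "subsemimodule K N E \<longleftrightarrow> N \<subseteq> carrier E \<and> \<zero>\<^bsub>E\<^esub> \<in> N \<and>
     (\<forall>x\<in>N. \<forall>y\<in>N. x \<oplus>\<^bsub>E\<^esub> y \<in> N) \<and> (\<forall>a\<in>carrier K. \<forall>x\<in>N. a \<odot>\<^bsub>E\<^esub> x \<in> N)"

definition generates ::
    "('k, 'r) ring_scheme \<Rightarrow> ('k, 'e, 'z) module_scheme \<Rightarrow> 'e set \<Rightarrow> bool" where
  "generates K E S \<longleftrightarrow> S \<subseteq> carrier E \<and> \<Inter>{N. subsemimodule K N E \<and> S \<subseteq> N} = carrier E"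

text \<open>The rank is \<open>\<infinity>\<close> when there is no finite set of generators.\<close>

definition rk :: "('k, 'r) ring_scheme \<Rightarrow> ('k, 'e, 'z) module_scheme \<Rightarrow> enat" where
  "rk K E = Inf {enat (card S) | S. finite S \<and> generates K E S}"

text \<open>A basis: every element is, in exactly one way, a linear combination with finitely
  supported coefficients.\<close>

definition is_basis ::
    "('k, 'r) ring_scheme \<Rightarrow> ('k, 'e, 'z) module_scheme \<Rightarrow> 'e set \<Rightarrow> bool" where
  "is_basis K E S \<longleftrightarrow> S \<subseteq> carrier E \<and>
     (\<forall>x\<in>carrier E. \<exists>!c. c \<in> S \<rightarrow>\<^sub>E carrier K \<and> finite {s\<in>S. c s \<noteq> \<zero>\<^bsub>K\<^esub>} \<and>
        x = (\<Oplus>\<^bsub>E\<^esub>s\<in>{s\<in>S. c s \<noteq> \<zero>\<^bsub>K\<^esub>}. c s \<odot>\<^bsub>E\<^esub> s))"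

definition free_semimodule ::
    "('k, 'r) ring_scheme \<Rightarrow> ('k, 'e, 'z) module_scheme \<Rightarrow> bool" where
  "free_semimodule K E \<longleftrightarrow> semimodule K E \<and> (\<exists>S. is_basis K E S)"

text \<open>\<open>Sup\<close> on \<open>enat\<close> is the maximum if there is one, and \<open>\<infinity>\<close> if the ranks of the free
  subsemimodules are unbounded. The zero subsemimodule is free of rank \<open>0\<close>.\<close>

definition free_rk :: "('k, 'r) ring_scheme \<Rightarrow> ('k, 'e, 'z) module_scheme \<Rightarrow> enat" where
  "free_rk K E = Sup {enat n | n. \<exists>N. subsemimodule K N E \<and>
     free_semimodule K (E\<lparr>carrier := N\<rparr>) \<and> rk K (E\<lparr>carrier := N\<rparr>) = enat n}"

text \<open>Maps between semimodules are extensional (\<open>undefined\<close> outside the source), so that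
  equality of maps is equality of HOL functions.\<close>

definition linear_maps :: "('k, 'r) ring_scheme \<Rightarrow> ('k, 'e, 'y) module_scheme \<Rightarrow>
    ('k, 'f, 'z) module_scheme \<Rightarrow> ('e \<Rightarrow> 'f) set" where
  "linear_maps K E F = {f \<in> carrier E \<rightarrow>\<^sub>E carrier F.
     (\<forall>x\<in>carrier E. \<forall>y\<in>carrier E. f (x \<oplus>\<^bsub>E\<^esub> y) = f x \<oplus>\<^bsub>F\<^esub> f y) \<and>
     (\<forall>a\<in>carrier K. \<forall>x\<in>carrier E. f (a \<odot>\<^bsub>E\<^esub> x) = a \<odot>\<^bsub>F\<^esub> f x)}"

definition linear_isos :: "('k, 'r) ring_scheme \<Rightarrow> ('k, 'e, 'y) module_scheme \<Rightarrow>
    ('k, 'f, 'z) module_scheme \<Rightarrow> ('e \<Rightarrow> 'f) set" where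
  "linear_isos K E F = {f \<in> linear_maps K E F. bij_betw f (carrier E) (carrier F)}"

definition End_semiring ::
    "('k, 'r) ring_scheme \<Rightarrow> ('k, 'e, 'z) module_scheme \<Rightarrow> ('e \<Rightarrow> 'e) ring" where
  "End_semiring K E = \<lparr>carrier = linear_maps K E E,
     monoid.mult = compose (carrier E), one = (\<lambda>x\<in>carrier E. x),
     zero = (\<lambda>x\<in>carrier E. \<zero>\<^bsub>E\<^esub>), add = (\<lambda>f g. \<lambda>x\<in>carrier E. f x \<oplus>\<^bsub>E\<^esub> g x)\<rparr>"

text \<open>Lifting along surjections \<open>M \<rightarrow> N\<close>. HOL cannot quantify over types in a definition, so the
  types of the elements of \<open>M\<close> and \<open>N\<close> are parameters; in a theorem they are free type variables,
  hence arbitrary.\<close>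

definition projective_semimodule :: "'m itself \<Rightarrow> 'n itself \<Rightarrow>
    ('k, 'r) ring_scheme \<Rightarrow> ('k, 'e, 'z) module_scheme \<Rightarrow> bool" where
  "projective_semimodule _ _ K E \<longleftrightarrow> semimodule K E \<and>
     (\<forall>(M :: ('k, 'm) module) (N :: ('k, 'n) module).
        semimodule K M \<longrightarrow> semimodule K N \<longrightarrow>
        (\<forall>g\<in>linear_maps K M N. g ` carrier M = carrier N \<longrightarrow>
          (\<forall>f\<in>linear_maps K E N. \<exists>h\<in>linear_maps K E M. \<forall>x\<in>carrier E. g (h x) = f x)))"


section \<open>Categories\<close>

text \<open>Hom-sets need not be disjoint, so composition carries its three objects:
  \<open>Comp C X Y Z g f\<close> is \<open>g\<close> after \<open>f\<close> for \<open>f \<in> Hom C X Y\<close>, \<open>g \<in> Hom C Y Z\<close>.\<close>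

record ('o, 'm) cat =
  Obj :: "'o set"
  Hom :: "'o \<Rightarrow> 'o \<Rightarrow> 'm set"
  Idn :: "'o \<Rightarrow> 'm"
  Comp :: "'o \<Rightarrow> 'o \<Rightarrow> 'o \<Rightarrow> 'm \<Rightarrow> 'm \<Rightarrow> 'm"

definition category :: "('o, 'm) cat \<Rightarrow> bool" where
  "category C \<longleftrightarrow>
     (\<forall>X\<in>Obj C. Idn C X \<in> Hom C X X) \<and>
     (\<forall>X\<in>Obj C. \<forall>Y\<in>Obj C. \<forall>Z\<in>Obj C. \<forall>f\<in>Hom C X Y. \<forall>g\<in>Hom C Y Z.
        Comp C X Y Z g f \<in> Hom C X Z) \<and>
     (\<forall>X\<in>Obj C. \<forall>Y\<in>Obj C. \<forall>f\<in>Hom C X Y.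
        Comp C X X Y f (Idn C X) = f \<and> Comp C X Y Y (Idn C Y) f = f) \<and>
     (\<forall>W\<in>Obj C. \<forall>X\<in>Obj C. \<forall>Y\<in>Obj C. \<forall>Z\<in>Obj C.
        \<forall>f\<in>Hom C W X. \<forall>g\<in>Hom C X Y. \<forall>h\<in>Hom C Y Z.
        Comp C W X Z (Comp C X Y Z h g) f = Comp C W Y Z h (Comp C W X Y g f))"

definition full_subcategory :: "('o, 'm) cat \<Rightarrow> 'o set \<Rightarrow> ('o, 'm) cat" where
  "full_subcategory C S = C\<lparr>Obj := S\<rparr>"

text \<open>An isomorphism of categories (not merely an equivalence), given by its action on objects
  and on morphisms.\<close>

definition category_iso :: "('o, 'm) cat \<Rightarrow> ('p, 'n) cat \<Rightarrow> ('o \<Rightarrow> 'p) \<Rightarrow>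
    ('o \<Rightarrow> 'o \<Rightarrow> 'm \<Rightarrow> 'n) \<Rightarrow> bool" where
  "category_iso C D Fo Fm \<longleftrightarrow> category C \<and> category D \<and>
     bij_betw Fo (Obj C) (Obj D) \<and>
     (\<forall>X\<in>Obj C. \<forall>Y\<in>Obj C. bij_betw (Fm X Y) (Hom C X Y) (Hom D (Fo X) (Fo Y))) \<and>
     (\<forall>X\<in>Obj C. Fm X X (Idn C X) = Idn D (Fo X)) \<and>
     (\<forall>X\<in>Obj C. \<forall>Y\<in>Obj C. \<forall>Z\<in>Obj C. \<forall>f\<in>Hom C X Y. \<forall>g\<in>Hom C Y Z.
        Fm X Z (Comp C X Y Z g f) = Comp D (Fo X) (Fo Y) (Fo Z) (Fm Y Z g) (Fm X Y f))"

definition simplicial_category :: "(nat set, nat \<Rightarrow> nat) cat" where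
  "simplicial_category = \<lparr>Obj = range (\<lambda>n. {0..n}),
     Hom = (\<lambda>X Y. {f \<in> X \<rightarrow>\<^sub>E Y. mono_on X f}),
     Idn = (\<lambda>X. \<lambda>x\<in>X. x),
     Comp = (\<lambda>X Y Z. compose X)\<rparr>"


section \<open>The category of semimodules and projective classes of semilinear maps\<close>

definition semifield_endos :: "('k, 'r) ring_scheme \<Rightarrow> ('k \<Rightarrow> 'k) set" where
  "semifield_endos K = {\<sigma> \<in> Ring.ring_hom K K. \<sigma> \<zero>\<^bsub>K\<^esub> = \<zero>\<^bsub>K\<^esub>}"

definition semilinear_maps :: "('k, 'r) ring_scheme \<Rightarrow> ('k, 'e, 'y) module_scheme \<Rightarrow>
    ('k, 'f, 'z) module_scheme \<Rightarrow> ('e \<Rightarrow> 'f) set" where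
  "semilinear_maps K E F = {f \<in> carrier E \<rightarrow>\<^sub>E carrier F.
     (\<forall>x\<in>carrier E. \<forall>y\<in>carrier E. f (x \<oplus>\<^bsub>E\<^esub> y) = f x \<oplus>\<^bsub>F\<^esub> f y) \<and>
     (\<exists>\<sigma>\<in>semifield_endos K. \<forall>a\<in>carrier K. \<forall>x\<in>carrier E. f (a \<odot>\<^bsub>E\<^esub> x) = \<sigma> a \<odot>\<^bsub>F\<^esub> f x)}"

definition zero_kernel ::
    "('e, 'y) ring_scheme \<Rightarrow> ('f, 'z) ring_scheme \<Rightarrow> ('e \<Rightarrow> 'f) \<Rightarrow> bool" where
  "zero_kernel E F f \<longleftrightarrow> {x \<in> carrier E. f x = \<zero>\<^bsub>F\<^esub>} = {\<zero>\<^bsub>E\<^esub>}"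

definition projective_class :: "('k, 'r) ring_scheme \<Rightarrow> ('k, 'e, 'y) module_scheme \<Rightarrow>
    ('k, 'f, 'z) module_scheme \<Rightarrow> ('e \<Rightarrow> 'f) \<Rightarrow> ('e \<Rightarrow> 'f) set" where
  "projective_class K E F f =
     {\<lambda>x\<in>carrier E. a \<odot>\<^bsub>F\<^esub> f x | a. a \<in> carrier K - {\<zero>\<^bsub>K\<^esub>}}"

text \<open>The objects are the semimodules whose elements are taken from the type \<open>'e\<close>. The set of all
  composites of representatives is the class of the composite of any two representatives.\<close>

definition proj_category ::
    "('k, 'r) ring_scheme \<Rightarrow> (('k, 'e) module, ('e \<Rightarrow> 'e) set) cat" where
  "proj_category K = \<lparr>Obj = {E. semimodule K E},
     Hom = (\<lambda>E F. projective_class K E F ` {f \<in> semilinear_maps K E F. zero_kernel E F f}),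
     Idn = (\<lambda>E. projective_class K E E (\<lambda>x\<in>carrier E. x)),
     Comp = (\<lambda>E F G gs fs. {compose (carrier E) g f | g f. g \<in> gs \<and> f \<in> fs})\<rparr>"


section \<open>The semifield of two elements with \<open>1 + 1 = 1\<close>\<close>

datatype bsf = BZero | BOne

instantiation bsf :: comm_semiring_1
begin

definition zero_bsf :: bsf where "0 = BZero"
definition one_bsf :: bsf where "1 = BOne"
fun plus_bsf :: "bsf \<Rightarrow> bsf \<Rightarrow> bsf" where
  "plus_bsf BZero y = y"
| "plus_bsf BOne y = BOne"
fun times_bsf :: "bsf \<Rightarrow> bsf \<Rightarrow> bsf" where
  "times_bsf BZero y = BZero"
| "times_bsf BOne y = y"

instance
proof
  fix a b c :: bsf
  show "a + b + c = a + (b + c)" by (cases a) auto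
  show "a + b = b + a" by (cases a; cases b) auto
  show "0 + a = a" by (simp add: zero_bsf_def)
  show "a * b * c = a * (b * c)" by (cases a) auto
  show "a * b = b * a" by (cases a; cases b) auto
  show "1 * a = a" by (simp add: one_bsf_def)
  show "(a + b) * c = a * c + b * c" by (cases a; cases b; cases c) auto
  show "0 * a = 0" "a * 0 = 0" by (cases a; simp add: zero_bsf_def)+
  show "(0::bsf) \<noteq> 1" by (simp add: zero_bsf_def one_bsf_def)
qed

end

definition BB :: "bsf ring" where
  "BB = \<lparr>carrier = UNIV, monoid.mult = (*), one = 1, zero = 0, add = (+)\<rparr>"

text \<open>\<open>X\<^sup>\<or>\<close> for a semi-lattice \<open>X\<close>: \<open>None\<close> is the adjoined \<open>0\<close>.\<close>

definition adjoin_zero :: "('x, 'z) gorder_scheme \<Rightarrow> (bsf, 'x option) module" where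
  "adjoin_zero X = \<lparr>carrier = insert None (Some ` carrier X),
     monoid.mult = undefined, one = undefined, zero = None,
     add = (\<lambda>x y. case x of None \<Rightarrow> y | Some i \<Rightarrow>
              (case y of None \<Rightarrow> x | Some j \<Rightarrow> Some (i \<squnion>\<^bsub>X\<^esub> j))),
     smult = (\<lambda>a x. case a of BZero \<Rightarrow> None | BOne \<Rightarrow> x)\<rparr>"

definition chain :: "nat \<Rightarrow> nat gorder" where
  "chain n = \<lparr>carrier = {1..n}, eq = (=), le = (\<le>)\<rparr>"

definition Bn1 :: "nat \<Rightarrow> (bsf, nat option) module" where
  "Bn1 n = adjoin_zero (chain n)"

definition mat_range :: "nat \<Rightarrow> 'a::semiring_1 mat \<Rightarrow> ('a, 'a vec) module" where
  "mat_range n P = (module_vec TYPE('a) n)\<lparr>carrier := (\<lambda>v. P *\<^sub>v v) ` carrier_vec n\<rparr>"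

definition corner_semiring :: "nat \<Rightarrow> 'a::semiring_1 mat \<Rightarrow> 'a mat ring" where
  "corner_semiring n P = \<lparr>carrier = (\<lambda>A. P * A * P) ` carrier_mat n n,
     monoid.mult = (*), one = P, zero = 0\<^sub>m n n, add = (+)\<rparr>"

text \<open>The extension by \<open>0 \<mapsto> 0\<close> of a map \<open>f\<close> defined on \<open>{0..m}\<close>, transported along the order
  isomorphisms \<open>i \<mapsto> i + 1\<close> from \<open>{0..m}\<close> to \<open>{1..m+1}\<close>.\<close>

definition extend_zero :: "nat set \<Rightarrow> (nat \<Rightarrow> nat) \<Rightarrow> nat option \<Rightarrow> nat option" where
  "extend_zero X f = (\<lambda>x\<in>insert None (Some ` Suc ` X). map_option (\<lambda>i. Suc (f (i - 1))) x)"

end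

theory Submission
  imports Defs
begin

text \<open>If \<open>x + y \<notin> {x, y}\<close>, then \<open>{0, x, y, x + y}\<close> is free of rank 2, while the sum of two
  distinct elements of a basis is neither of them; hence the selective semimodules are those of free rank at most 1. A
  selective semimodule is a chain above 0, and every generating set contains all its non-zero
  elements. An isomorphism preserves the number of non-zero elements below an element, which
  determines the isomorphism onto \<open>{1, \<dots>, n}\<^sup>\<or>\<close>. Linear maps between such chains are the monotone
  maps fixing 0, and \<open>{1, \<dots>, n}\<^sup>\<or>\<close> is realized in \<open>B\<^sup>n\<close> by the vectors \<open>(1, \<dots>, 1, 0, \<dots>, 0)\<close>.\<close>

section \<open>Semimodules over the Boolean semifield\<close>

text \<open>The zero semimodule is selective but has free rank 0, so the equivalence (i) has to
  exclude it. Over the two-element semifield a coefficient function amounts to its support; a basis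
  is thus a set for which taking the sum of a finite subset is a bijection onto the semimodule. The
  projection matrix is not guessed. A Boolean vector is retracted onto the vectors (1, ..., 1, 0,
  ..., 0) by filling in ones before its last 1. The matrix of this retraction is also the matrix
  attached to the identity of the chain, so its idempotence and the place of the other matrices in
  the corner are instances of a single composition law. In (iv) every projective class is a
  singleton. The kernel condition says that non-zero elements stay non-zero, so a morphism restricts
  to a monotone map from {1..m+1} to {1..n+1}, and a shift by one turns it into a map from [m] to
  [n].\<close>

lemma BB_simps [simp]:
  "carrier BB = UNIV" "\<zero>\<^bsub>BB\<^esub> = BZero" "\<one>\<^bsub>BB\<^esub> = BOne"
  "a \<oplus>\<^bsub>BB\<^esub> b = a + b" "a \<otimes>\<^bsub>BB\<^esub> b = a * b"
  by (simp_all add: BB_def zero_bsf_def one_bsf_def)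

text \<open>As a simp rule it brings supports of coefficient functions into the form used for
  \<open>supp\<close> in \<open>is_basis_iff\<close>.\<close>

lemma bsf_neq_iff [simp]: "a \<noteq> BZero \<longleftrightarrow> a = BOne"
  by (cases a) auto

text \<open>Matrices use the type class constants, semimodules the constructors; hence the two
  variants.\<close>

lemma bsf_neq_0 [simp]: "(a::bsf) \<noteq> 0 \<longleftrightarrow> a = 1"
  by (simp add: zero_bsf_def one_bsf_def)

lemma semifield_BB: "semifield BB"
proof -
  have "semiring BB"
    by (unfold_locales)
      (auto simp: BB_def Units_def algebra_simps intro!: exI[of _ 0])
  moreover have "comm_monoid BB"
    by unfold_locales (auto simp: BB_def algebra_simps)
  moreover have "group \<lparr>carrier = carrier BB - {\<zero>\<^bsub>BB\<^esub>}, monoid.mult = monoid.mult BB, one = \<one>\<^bsub>BB\<^esub>\<rparr>"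
    by (rule groupI) auto
  ultimately show ?thesis by (simp add: semifield_def)
qed

text \<open>Both scalars act in a forced way, and what remains of the axioms is idempotence, forced
  by 1 + 1 = 1. The objects are thus join semilattices with a least element.\<close>

locale bool_semimodule = abelian_monoid E for E :: "(bsf, 'e, 'z) module_scheme" (structure) +
  assumes smult_BOne [simp]: "x \<in> carrier E \<Longrightarrow> BOne \<odot> x = x"
    and smult_BZero [simp]: "x \<in> carrier E \<Longrightarrow> BZero \<odot> x = \<zero>"
    and add_idem [simp]: "x \<in> carrier E \<Longrightarrow> x \<oplus> x = x"

lemma semimodule_BB_iff: "semimodule BB E \<longleftrightarrow> bool_semimodule E"
proof
  assume E: "semimodule BB E"
  have "x \<oplus>\<^bsub>E\<^esub> x = x" if x: "x \<in> carrier E" for x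
  proof -
    \<comment> \<open>Distributivity is applied to the scalar 1 + 1 before this sum is evaluated to
      1.\<close>
    have "(BOne + BOne) \<odot>\<^bsub>E\<^esub> x = BOne \<odot>\<^bsub>E\<^esub> x \<oplus>\<^bsub>E\<^esub> BOne \<odot>\<^bsub>E\<^esub> x" "BOne \<odot>\<^bsub>E\<^esub> x = x"
      using E x by (simp_all add: semimodule_def del: plus_bsf.simps)
    then show ?thesis by simp
  qed
  with E show "bool_semimodule E"
    by (simp add: bool_semimodule_def bool_semimodule_axioms_def semimodule_def)
next
  assume "bool_semimodule E"
  then interpret bool_semimodule E .
  have "a \<odot>\<^bsub>E\<^esub> x \<in> carrier E" "a \<odot>\<^bsub>E\<^esub> (x \<oplus>\<^bsub>E\<^esub> y) = a \<odot>\<^bsub>E\<^esub> x \<oplus>\<^bsub>E\<^esub> a \<odot>\<^bsub>E\<^esub> y"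
    "(a + b) \<odot>\<^bsub>E\<^esub> x = a \<odot>\<^bsub>E\<^esub> x \<oplus>\<^bsub>E\<^esub> b \<odot>\<^bsub>E\<^esub> x" "(a * b) \<odot>\<^bsub>E\<^esub> x = a \<odot>\<^bsub>E\<^esub> (b \<odot>\<^bsub>E\<^esub> x)"
    if "x \<in> carrier E" "y \<in> carrier E" for a b x y
    using that by (cases a; cases b; simp)+
  then show "semimodule BB E"
    by (auto simp: semimodule_def semifield_BB abelian_monoid_axioms)
qed

text \<open>Unique existence means that the solution set has one element, and the bijection
  restricts to the solution sets. It serves to pass from coefficient functions to subsets.\<close>

lemma bij_betw_Ex1:
  assumes "bij_betw f A B"
  shows "(\<exists>!a. a \<in> A \<and> Q (f a)) \<longleftrightarrow> (\<exists>!b. b \<in> B \<and> Q b)"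
proof -
  have "(\<exists>!a. a \<in> A \<and> Q (f a)) \<longleftrightarrow> is_singleton {a \<in> A. Q (f a)}"
    "(\<exists>!b. b \<in> B \<and> Q b) \<longleftrightarrow> is_singleton {b \<in> B. Q b}"
    by (auto simp: is_singleton_def set_eq_iff Ex1_def)
  moreover have "bij_betw f {a \<in> A. Q (f a)} {b \<in> B. Q b}"
    using assms by (auto simp: bij_betw_def inj_on_def)
  ultimately show ?thesis by (simp add: is_singleton_altdef bij_betw_same_card)
qed

context bool_semimodule
begin

lemma add_absorb:
  assumes "x \<in> carrier E" "y \<in> carrier E"
  shows "x \<oplus> (x \<oplus> y) = x \<oplus> y"
  using assms by (metis a_assoc add_idem)

text \<open>Adding x to both sides of x + y = 0 leaves the left side unchanged and turns the right
  side into x.\<close>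

lemma add_zeroD:
  assumes "x \<in> carrier E" "y \<in> carrier E" "x \<oplus> y = \<zero>"
  shows "x = \<zero>"
  using add_absorb[OF assms(1,2)] assms by simp

text \<open>Closure under scalars is automatic, since a scalar multiple of x is x or zero.\<close>

lemma subsemimodule_iff:
  "subsemimodule BB N E \<longleftrightarrow> N \<subseteq> carrier E \<and> \<zero> \<in> N \<and> (\<forall>x\<in>N. \<forall>y\<in>N. x \<oplus> y \<in> N)"
proof -
  have "a \<odot> x \<in> N" if "N \<subseteq> carrier E" "\<zero> \<in> N" "x \<in> N" for a x
    using that by (cases a) (auto simp: subset_iff)
  then show ?thesis by (auto simp: subsemimodule_def)
qed

lemma subsemimodule_bool_semimodule:
  assumes "subsemimodule BB N E"
  shows "bool_semimodule (E\<lparr>carrier := N\<rparr>)"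
proof -
  have N: "N \<subseteq> carrier E" "\<zero> \<in> N" "\<And>x y. x \<in> N \<Longrightarrow> y \<in> N \<Longrightarrow> x \<oplus> y \<in> N"
    using assms by (auto simp: subsemimodule_iff)
  have "abelian_monoid (E\<lparr>carrier := N\<rparr>)"
    by (rule abelian_monoidI) (use N in \<open>auto simp: subset_iff a_assoc intro: a_comm\<close>)
  then show ?thesis
    using N by (auto simp: bool_semimodule_def bool_semimodule_axioms_def subset_iff)
qed

lemma generates_iff:
  "generates BB E S \<longleftrightarrow>
     S \<subseteq> carrier E \<and> (\<forall>N. subsemimodule BB N E \<and> S \<subseteq> N \<longrightarrow> carrier E \<subseteq> N)"
proof -
  have "subsemimodule BB (carrier E) E" by (simp add: subsemimodule_iff)
  then show ?thesis unfolding generates_def by blast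
qed

text \<open>An extensional function into \<open>bsf\<close> is determined by the set where it is 1,
  and on this set the coefficients disappear from the sum.\<close>

lemma is_basis_iff:
  "is_basis BB E S \<longleftrightarrow> S \<subseteq> carrier E \<and>
     (\<forall>x\<in>carrier E. \<exists>!T. T \<subseteq> S \<and> finite T \<and> x = (\<Oplus>s\<in>T. s))"
proof (cases "S \<subseteq> carrier E")
  case True
  define supp where "supp c = {s\<in>S. c s = BOne}" for c :: "'e \<Rightarrow> bsf"
  have sum: "(\<Oplus>s\<in>supp c. c s \<odot> s) = (\<Oplus>s\<in>supp c. s)" for c
    using True by (intro finsum_cong') (auto simp: supp_def)
  have inj: "inj_on supp (S \<rightarrow>\<^sub>E UNIV)"
  proof (rule inj_onI)
    fix c d assume *: "c \<in> S \<rightarrow>\<^sub>E UNIV" "d \<in> S \<rightarrow>\<^sub>E UNIV" "supp c = supp d"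
    show "c = d"
    proof (rule PiE_ext[OF *(1,2)])
      fix s assume "s \<in> S"
      with *(3) have "c s = BOne \<longleftrightarrow> d s = BOne" by (auto simp: supp_def)
      then show "c s = d s" by (metis bsf_neq_iff)
    qed
  qed
  have surj: "\<exists>c\<in>S \<rightarrow>\<^sub>E UNIV. supp c = T" if "T \<subseteq> S" for T
    using that by (intro bexI[of _ "\<lambda>s\<in>S. if s \<in> T then BOne else BZero"]) (auto simp: supp_def)
  have "bij_betw supp (S \<rightarrow>\<^sub>E UNIV) (Pow S)"
    by (rule bij_betw_imageI[OF inj]) (use surj in \<open>auto simp: supp_def\<close>)
  from bij_betw_Ex1[OF this, of "\<lambda>T. finite T \<and> x = (\<Oplus>s\<in>T. s)" for x]
  have "(\<exists>!c. c \<in> S \<rightarrow>\<^sub>E UNIV \<and> finite (supp c) \<and> x = (\<Oplus>s\<in>supp c. s)) \<longleftrightarrow>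
      (\<exists>!T. T \<subseteq> S \<and> finite T \<and> x = (\<Oplus>s\<in>T. s))" for x by simp
  then show ?thesis
    using True by (simp add: is_basis_def supp_def[symmetric] sum)
qed (simp add: is_basis_def)

lemma basis_generates:
  assumes "is_basis BB E S"
  shows "generates BB E S"
  unfolding generates_iff
proof (intro conjI allI impI subsetI; (elim conjE)?)
  fix N x assume N: "subsemimodule BB N E" "S \<subseteq> N" and x: "x \<in> carrier E"
  obtain T where T: "T \<subseteq> S" "finite T" "x = (\<Oplus>s\<in>T. s)"
    using assms x unfolding is_basis_iff by blast
  have "(\<Oplus>s\<in>T. s) \<in> N" using T(2,1)
  proof (induction T rule: finite_induct)
    case empty
    then show ?case using N by (simp add: subsemimodule_iff)
  next
    case (insert s T)
    then have "s \<in> N" "insert s T \<subseteq> carrier E" using N by (auto simp: subsemimodule_iff)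
    with insert N show ?case by (auto simp: subsemimodule_iff subset_iff Pi_iff)
  qed
  with T show "x \<in> N" by simp
qed (use assms in \<open>auto simp: is_basis_iff\<close>)

lemma rk_le: "finite S \<Longrightarrow> generates BB E S \<Longrightarrow> rk BB E \<le> enat (card S)"
  unfolding rk_def by (rule Inf_lower) blast

lemma rk_geI:
  "(\<And>S. finite S \<Longrightarrow> generates BB E S \<Longrightarrow> n \<le> enat (card S)) \<Longrightarrow> n \<le> rk BB E"
  unfolding rk_def by (rule Inf_greatest) blast

text \<open>A finite value rules out the infimum of the empty set, and a non-empty set in
  \<open>enat\<close> contains its infimum.\<close>

lemma rk_attained:
  assumes "rk BB E = enat n"
  obtains S where "finite S" "generates BB E S" "card S = n"
proof -
  let ?A = "{enat (card S) | S. finite S \<and> generates BB E S}"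
  have "?A \<noteq> {}"
    using assms unfolding rk_def by (metis Inf_empty top_enat_def enat.distinct(1))
  then have "Inf ?A \<in> ?A" unfolding Inf_enat_def by (metis (no_types, lifting) LeastI ex_in_conv)
  then show ?thesis using assms that unfolding rk_def by auto
qed

text \<open>In a selective semimodule every subset containing \<open>\<zero>\<close> is a subsemimodule.\<close>

lemma selective_generates:
  assumes "selective E"
  shows "generates BB E S \<longleftrightarrow> carrier E - {\<zero>} \<subseteq> S \<and> S \<subseteq> carrier E"
proof
  assume S: "generates BB E S"
  then have "S \<subseteq> carrier E" by (simp add: generates_iff)
  moreover from this have "subsemimodule BB (insert \<zero> S) E"
    using assms unfolding subsemimodule_iff selective_def
    by (auto simp: subset_iff) (metis insert_iff empty_iff)+
  ultimately show "carrier E - {\<zero>} \<subseteq> S \<and> S \<subseteq> carrier E"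
    using S unfolding generates_iff by blast
qed (auto simp: generates_iff subsemimodule_iff)

lemma selective_rk:
  assumes "selective E" "finite (carrier E)"
  shows "rk BB E = enat (card (carrier E - {\<zero>}))"
proof (rule antisym)
  show "rk BB E \<le> enat (card (carrier E - {\<zero>}))"
    using assms by (intro rk_le) (auto simp: selective_generates)
  show "enat (card (carrier E - {\<zero>})) \<le> rk BB E"
    using assms by (intro rk_geI) (auto simp: selective_generates simp del: card_Diff_insert intro!: card_mono)
qed

text \<open>A single generator s spans only {0, s}, which has no room for the three distinct
  elements 0, x and y.\<close>

lemma two_generators_rk:
  assumes "x \<in> carrier E" "y \<in> carrier E" "x \<noteq> \<zero>" "y \<noteq> \<zero>" "x \<noteq> y" "generates BB E {x, y}"
  shows "rk BB E = enat 2"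
proof (rule antisym)
  show "rk BB E \<le> enat 2" using rk_le[OF _ assms(6)] assms(5) by (simp add: numeral_2_eq_2)
  show "enat 2 \<le> rk BB E"
  proof (rule rk_geI, rule ccontr)
    fix S assume S: "finite S" "generates BB E S" "\<not> enat 2 \<le> enat (card S)"
    then have "card S \<le> Suc 0" by simp
    then have S1: "\<forall>s\<in>S. \<forall>t\<in>S. s = t" using card_le_Suc0_iff_eq[OF S(1)] by blast
    \<comment> \<open>An empty S is treated together with the singletons, with x as a dummy
      generator.\<close>
    obtain s where s: "S \<subseteq> {s}" "s \<in> carrier E"
    proof (cases "S = {}")
      case False
      then obtain s where "s \<in> S" by blast
      with S1 S(2) show ?thesis by (intro that[of s]) (auto simp: generates_iff)
    qed (use assms(1) that in auto)
    then have "subsemimodule BB {\<zero>, s} E" by (auto simp: subsemimodule_iff)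
    then have "carrier E \<subseteq> {\<zero>, s}" using S(2) s(1) unfolding generates_iff by blast
    with assms(1-5) show False by auto
  qed
qed

end

section \<open>Free rank and selectivity\<close>

lemma free_semimodule_BB_iff:
  "free_semimodule BB E \<longleftrightarrow> bool_semimodule E \<and> (\<exists>S. is_basis BB E S)"
  by (simp add: free_semimodule_def semimodule_BB_iff)

context bool_semimodule
begin

lemma free_rk_le_1:
  assumes "selective E"
  shows "free_rk BB E \<le> 1"
  unfolding free_rk_def
proof (rule Sup_least, clarify)
  fix n N assume N: "subsemimodule BB N E" "free_semimodule BB (E\<lparr>carrier := N\<rparr>)"
    "rk BB (E\<lparr>carrier := N\<rparr>) = enat n"
  interpret N: bool_semimodule "E\<lparr>carrier := N\<rparr>"
    using N(1) by (rule subsemimodule_bool_semimodule)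
  obtain S where S: "is_basis BB (E\<lparr>carrier := N\<rparr>) S"
    using N(2) by (auto simp: free_semimodule_def)
  then have SN: "S \<subseteq> N" by (simp add: N.is_basis_iff)
  have eq: "s = t" if st: "s \<in> S" "t \<in> S" for s t
  proof (rule ccontr)
    assume "s \<noteq> t"
    let ?sum = "\<lambda>T. finsum (E\<lparr>carrier := N\<rparr>) (\<lambda>s. s) T"
    have "?sum {s} = s" "?sum {t} = t" "?sum {s, t} = s \<oplus> t"
      using st SN \<open>s \<noteq> t\<close> N.finsum_insert[of "{t}" s "\<lambda>s. s"]  N.finsum_insert[of "{}" s "\<lambda>s. s"]
         N.finsum_insert[of "{}" t "\<lambda>s. s"] N.r_zero
      by (auto simp: subset_iff)
    moreover have "s \<oplus> t = s \<or> s \<oplus> t = t"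
      using assms N(1) st SN by (auto simp: selective_def subsemimodule_iff subset_iff)
    ultimately have "?sum {s, t} = ?sum {s} \<or> ?sum {s, t} = ?sum {t}" by metis
    \<comment> \<open>Uniqueness of the representation, read as injectivity of the sum on the finite
      subsets of the basis.\<close>
    moreover have "T = T'" if "T \<subseteq> S" "T' \<subseteq> S" "finite T" "finite T'" "?sum T = ?sum T'" for T T'
    proof -
      have "?sum T \<in> N" using N.finsum_closed[of "\<lambda>s. s" T] that SN by (auto simp: subset_iff)
      then have "\<exists>\<^sub>\<le>\<^sub>1T'. T' \<subseteq> S \<and> finite T' \<and> ?sum T = ?sum T'"
        using S by (simp add: N.is_basis_iff ex1_iff_ex_Uniq)
      then show ?thesis by (rule Uniq_D) (use that in auto)
    qed
    ultimately have "{s, t} = {s} \<or> {s, t} = {t}" using st by (metis empty_subsetI finite.emptyI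
      finite.insertI insert_subset)
    with \<open>s \<noteq> t\<close> show False by auto
  qed
  then have "finite S" by (metis finite.simps is_singletonI' is_singleton_def)
  with eq have "card S \<le> 1" by (simp add: card_le_Suc0_iff_eq)
  then show "enat n \<le> 1"
    using N.rk_le[OF \<open>finite S\<close> N.basis_generates[OF S]] N(3)
    by (metis dual_order.trans enat_ord_simps(1) one_enat_def)
qed

text \<open>The line {0, x} is a copy of the semifield itself, free on x.\<close>

lemma free_rk_ge_1:
  assumes "x \<in> carrier E" "x \<noteq> \<zero>"
  shows "1 \<le> free_rk BB E"
proof -
  let ?N = "{\<zero>, x}"
  have sub: "subsemimodule BB ?N E" using assms by (simp add: subsemimodule_iff)
  interpret N: bool_semimodule "E\<lparr>carrier := ?N\<rparr>"
    using sub by (rule subsemimodule_bool_semimodule)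
  have "selective (E\<lparr>carrier := ?N\<rparr>)"
    using assms N.abelian_monoid_axioms by (auto simp: selective_def)
  from N.selective_rk[OF this] have rk: "rk BB (E\<lparr>carrier := ?N\<rparr>) = enat 1"
    using assms by (simp add: insert_Diff_if)
  have sums: "finsum (E\<lparr>carrier := ?N\<rparr>) (\<lambda>s. s) {} = \<zero>" "finsum (E\<lparr>carrier := ?N\<rparr>) (\<lambda>s. s) {x} = x"
    using assms N.finsum_insert[of "{}" x "\<lambda>s. s"] N.r_zero by auto
  have "is_basis BB (E\<lparr>carrier := ?N\<rparr>) {x}"
    unfolding N.is_basis_iff
  proof (intro conjI ballI)
    fix z assume "z \<in> carrier (E\<lparr>carrier := ?N\<rparr>)"
    then consider "z = \<zero>" | "z = x" by auto
    then show "\<exists>!T. T \<subseteq> {x} \<and> finite T \<and> z = finsum (E\<lparr>carrier := ?N\<rparr>) (\<lambda>s. s) T"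
    proof cases
      case 1
      with assms sums show ?thesis by (intro ex1I[of _ "{}"]) (auto simp: subset_singleton_iff)
    next
      case 2
      with assms sums show ?thesis by (intro ex1I[of _ "{x}"]) (auto simp: subset_singleton_iff)
    qed
  qed simp
  then have "free_semimodule BB (E\<lparr>carrier := ?N\<rparr>)"
    using N.bool_semimodule_axioms by (auto simp: free_semimodule_BB_iff)
  with sub rk show ?thesis
    unfolding free_rk_def one_enat_def by (intro Sup_upper) blast
qed

text \<open>The assumption makes 0, x, y and x + y four different elements, so they correspond to
  the four subsets of {x, y} and form a copy of the square of the semifield.\<close>

lemma free_rk_ge_2:
  assumes xy: "x \<in> carrier E" "y \<in> carrier E" "x \<oplus> y \<notin> {x, y}"
  shows "enat 2 \<le> free_rk BB E"
proof -
  let ?N = "{\<zero>, x, y, x \<oplus> y}"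
  let ?sum = "\<lambda>T. finsum (E\<lparr>carrier := ?N\<rparr>) (\<lambda>s. s) T"
  have ne: "x \<noteq> \<zero>" "y \<noteq> \<zero>" "x \<noteq> y" "x \<oplus> y \<noteq> \<zero>"
    using xy add_zeroD[of x y] by auto
  have yx: "y \<oplus> x = x \<oplus> y" "y \<oplus> (x \<oplus> y) = x \<oplus> y" "x \<oplus> y \<oplus> x = x \<oplus> y" "x \<oplus> y \<oplus> y = x \<oplus> y"
    "x \<oplus> (x \<oplus> y) = x \<oplus> y"
    using xy by (metis a_comm a_assoc add_idem a_closed)+
  have sub: "subsemimodule BB ?N E" using xy yx by (auto simp: subsemimodule_iff)
  interpret N: bool_semimodule "E\<lparr>carrier := ?N\<rparr>"
    using sub by (rule subsemimodule_bool_semimodule)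
  have sums: "?sum {} = \<zero>" "?sum {x} = x" "?sum {y} = y" "?sum {x, y} = x \<oplus> y"
    using xy ne N.finsum_insert[of "{}" x "\<lambda>s. s"] N.finsum_insert[of "{}" y "\<lambda>s. s"]
      N.finsum_insert[of "{y}" x "\<lambda>s. s"] N.r_zero by auto
  have Pow: "Pow {x, y} = {{}, {x}, {y}, {x, y}}" by auto
  have inj: "inj_on ?sum (Pow {x, y})"
    unfolding Pow using ne xy sums by (auto simp: inj_on_def)
  have N_eq: "?N = ?sum ` Pow {x, y}"
    unfolding Pow image_insert sums by simp
  have "\<exists>!T. T \<subseteq> {x, y} \<and> finite T \<and> z = ?sum T" if "z \<in> ?N" for z
  proof -
    \<comment> \<open>The set \<open>?N\<close> is also the carrier inside \<open>?sum\<close>; only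
      its outer occurrence is to be replaced by the image.\<close>
    have "z \<in> ?sum ` Pow {x, y}"
      by (rule subst[OF N_eq, of "\<lambda>A. z \<in> A"]) (rule that)
    then obtain T where "z = ?sum T" "T \<in> Pow {x, y}" by (rule imageE)
    then show ?thesis
      using finite_subset[of T "{x, y}"] by (intro ex1I[of _ T]) (auto dest: inj_onD[OF inj])
  qed
  then have basis: "is_basis BB (E\<lparr>carrier := ?N\<rparr>) {x, y}"
    unfolding N.is_basis_iff by auto
  have "rk BB (E\<lparr>carrier := ?N\<rparr>) = enat 2"
    by (rule N.two_generators_rk[OF _ _ _ _ ne(3) N.basis_generates[OF basis]]) (use ne in auto)
  moreover have "free_semimodule BB (E\<lparr>carrier := ?N\<rparr>)"
    using basis N.bool_semimodule_axioms by (auto simp: free_semimodule_BB_iff)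
  ultimately show ?thesis
    using sub unfolding free_rk_def by (intro Sup_upper) blast
qed

text \<open>The only subsemimodule is the zero one, which is generated by the empty set.\<close>

lemma free_rk_zero:
  assumes "carrier E = {\<zero>}"
  shows "free_rk BB E \<le> 0"
  unfolding free_rk_def
proof (rule Sup_least, clarify)
  fix n N assume N: "subsemimodule BB N E" "rk BB (E\<lparr>carrier := N\<rparr>) = enat n"
  interpret N: bool_semimodule "E\<lparr>carrier := N\<rparr>"
    using N(1) by (rule subsemimodule_bool_semimodule)
  have "N = {\<zero>}" using N(1) assms by (auto simp: subsemimodule_iff)
  then have "generates BB (E\<lparr>carrier := N\<rparr>) {}"
    unfolding N.generates_iff N.subsemimodule_iff by auto
  with N.rk_le[of "{}"] N(2) show "enat n \<le> 0" by (simp add: zero_enat_def)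
qed

lemma selective_iff_free_rk: "selective E \<and> carrier E \<noteq> {\<zero>} \<longleftrightarrow> free_rk BB E = 1"
proof
  assume E: "selective E \<and> carrier E \<noteq> {\<zero>}"
  then obtain x where "x \<in> carrier E" "x \<noteq> \<zero>" using zero_closed by blast
  then show "free_rk BB E = 1" using E free_rk_le_1 free_rk_ge_1 by (meson antisym)
next
  assume 1: "free_rk BB E = 1"
  then have "carrier E \<noteq> {\<zero>}" using free_rk_zero by auto
  moreover have "\<not> enat 2 \<le> free_rk BB E" using 1 by (simp add: one_enat_def)
  then have "selective E"
    using free_rk_ge_2 abelian_monoid_axioms unfolding selective_def by blast
  ultimately show "selective E \<and> carrier E \<noteq> {\<zero>}" by blast
qed

text \<open>A generating set of least size n omits zero, because every subsemimodule contains zero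
  anyway. Together with zero it has n + 1 elements, as many as \<open>{..n}\<close>.\<close>

lemma carrier_lepoll_of_rk:
  assumes "rk BB E = enat n"
  shows "{..n} \<lesssim> carrier E"
proof -
  obtain S where S: "finite S" "generates BB E S" "card S = n" using assms by (rule rk_attained)
  have "\<zero> \<notin> S"
  proof
    assume "\<zero> \<in> S"
    have "carrier E \<subseteq> N" if N: "subsemimodule BB N E" "S - {\<zero>} \<subseteq> N" for N
    proof -
      have "\<zero> \<in> N" using N(1) by (simp add: subsemimodule_iff)
      with N S(2) show ?thesis unfolding generates_iff by blast
    qed
    then have "generates BB E (S - {\<zero>})" using S(2) by (auto simp: generates_iff)
    then have "rk BB E \<le> enat (card (S - {\<zero>}))" using S(1) by (intro rk_le) auto
    also have "card (S - {\<zero>}) < n" using card_Diff1_less[OF S(1) \<open>\<zero> \<in> S\<close>] S(3) by simp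
    finally show False using assms by simp
  qed
  then have "{..n} \<lesssim> insert \<zero> S" using S by (simp add: lepoll_iff_card_le)
  moreover have "insert \<zero> S \<lesssim> carrier E"
    using S(2) by (intro subset_imp_lepoll) (auto simp: generates_iff)
  ultimately show ?thesis by (rule lepoll_trans)
qed

end

section \<open>Linear maps and the height in a selective semimodule\<close>

text \<open>Homogeneity is automatic for the scalar 1 and amounts to preserving zero for the scalar
  0.\<close>

lemma linear_maps_BB_iff:
  assumes "bool_semimodule E" "bool_semimodule F"
  shows "f \<in> linear_maps BB E F \<longleftrightarrow> f \<in> carrier E \<rightarrow>\<^sub>E carrier F \<and> f \<zero>\<^bsub>E\<^esub> = \<zero>\<^bsub>F\<^esub> \<and>
    (\<forall>x\<in>carrier E. \<forall>y\<in>carrier E. f (x \<oplus>\<^bsub>E\<^esub> y) = f x \<oplus>\<^bsub>F\<^esub> f y)"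
proof -
  interpret E: bool_semimodule E by fact
  interpret F: bool_semimodule F by fact
  have "f (a \<odot>\<^bsub>E\<^esub> x) = a \<odot>\<^bsub>F\<^esub> f x"
    if "f \<in> carrier E \<rightarrow>\<^sub>E carrier F" "f \<zero>\<^bsub>E\<^esub> = \<zero>\<^bsub>F\<^esub>" "x \<in> carrier E" for a x
    using that E.smult_BZero[of x] F.smult_BZero[of "f x"] F.smult_BOne[of "f x"] PiE_mem[OF that(1,3)]
    by (cases a) auto
  moreover have "f \<zero>\<^bsub>E\<^esub> = \<zero>\<^bsub>F\<^esub>"
    if "f \<in> carrier E \<rightarrow>\<^sub>E carrier F" "f (BZero \<odot>\<^bsub>E\<^esub> \<zero>\<^bsub>E\<^esub>) = BZero \<odot>\<^bsub>F\<^esub> f \<zero>\<^bsub>E\<^esub>"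
    using that(2) F.smult_BZero[OF PiE_mem[OF that(1) E.zero_closed]] by simp
  ultimately show ?thesis unfolding linear_maps_def by fastforce
qed

text \<open>The non-zero elements below x in the order of the semilattice are counted, x itself
  included. Only addition and zero enter, so that isomorphisms preserve the number.\<close>

definition height :: "('e, 'z) ring_scheme \<Rightarrow> 'e \<Rightarrow> nat" where
  "height E x = card {y \<in> carrier E - {\<zero>\<^bsub>E\<^esub>}. x \<oplus>\<^bsub>E\<^esub> y = x}"

lemma height_linear_iso:
  assumes "bool_semimodule E" "bool_semimodule F" "\<phi> \<in> linear_isos BB E F" "x \<in> carrier E"
  shows "height F (\<phi> x) = height E x"
proof -
  interpret E: bool_semimodule E by fact
  interpret F: bool_semimodule F by fact
  have \<phi>: "\<phi> \<in> linear_maps BB E F" "bij_betw \<phi> (carrier E) (carrier F)"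
    using assms(3) by (auto simp: linear_isos_def)
  have inj: "\<phi> y = \<phi> z \<longleftrightarrow> y = z" if "y \<in> carrier E" "z \<in> carrier E" for y z
    using \<phi>(2) that by (meson bij_betw_def inj_on_eq_iff)
  have img: "\<phi> ` carrier E = carrier F" using \<phi>(2) by (simp add: bij_betw_def)
  have zero: "\<phi> \<zero>\<^bsub>E\<^esub> = \<zero>\<^bsub>F\<^esub>"
    and add: "\<And>x y. x \<in> carrier E \<Longrightarrow> y \<in> carrier E \<Longrightarrow> \<phi> (x \<oplus>\<^bsub>E\<^esub> y) = \<phi> x \<oplus>\<^bsub>F\<^esub> \<phi> y"
    using \<phi>(1) by (auto simp: linear_maps_BB_iff[OF assms(1,2)])
  let ?D = "{y \<in> carrier E - {\<zero>\<^bsub>E\<^esub>}. x \<oplus>\<^bsub>E\<^esub> y = x}"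
  have iff: "\<phi> y \<noteq> \<zero>\<^bsub>F\<^esub> \<and> \<phi> x \<oplus>\<^bsub>F\<^esub> \<phi> y = \<phi> x \<longleftrightarrow> y \<in> ?D" if "y \<in> carrier E" for y
    using that inj[of y "\<zero>\<^bsub>E\<^esub>"] inj[of "x \<oplus>\<^bsub>E\<^esub> y" x] add[of x y] zero assms(4) by auto
  have "{z \<in> carrier F - {\<zero>\<^bsub>F\<^esub>}. \<phi> x \<oplus>\<^bsub>F\<^esub> z = \<phi> x} = \<phi> ` ?D"
    unfolding img[symmetric] using iff by auto
  moreover have "inj_on \<phi> ?D" using inj by (auto simp: inj_on_def)
  ultimately show ?thesis by (simp add: height_def card_image)
qed

context bool_semimodule
begin

context
  assumes selective: "selective E" and fin: "finite (carrier E)"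
begin

lemma height_mono:
  assumes "x \<in> carrier E" "y \<in> carrier E" "x \<oplus> y = y"
  shows "height E x \<le> height E y"
proof -
  have "y \<oplus> z = y" if "z \<in> carrier E" "x \<oplus> z = x" for z
    using assms that by (metis a_assoc a_comm)
  then show ?thesis
    unfolding height_def using fin by (intro card_mono) auto
qed

text \<open>The element y is counted for itself but not for x. It is non-zero, since otherwise x
  would be zero as well and equal to y.\<close>

lemma height_strict_mono:
  assumes "x \<in> carrier E" "y \<in> carrier E" "x \<oplus> y = y" "x \<noteq> y"
  shows "height E x < height E y"
proof -
  let ?D = "\<lambda>x. {y \<in> carrier E - {\<zero>}. x \<oplus> y = x}"
  have "y \<oplus> z = y" if "z \<in> carrier E" "x \<oplus> z = x" for z
    using assms that by (metis a_assoc a_comm)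
  moreover have "y \<noteq> \<zero>" using assms add_zeroD by metis
  then have "y \<in> ?D y" "y \<notin> ?D x" using assms by auto
  ultimately show ?thesis
    unfolding height_def using fin by (intro psubset_card_mono) auto
qed

text \<open>Selectivity is totality of the order in which x lies below y when x + y = y. The second
  case is the first with x and y exchanged, so that the lemmas above apply to both.\<close>

lemma selective_cases:
  assumes "x \<in> carrier E" "y \<in> carrier E"
  obtains "x \<oplus> y = y" | "y \<oplus> x = x"
  using assms selective unfolding selective_def by (metis a_comm empty_iff insert_iff)

lemma height_inj: "inj_on (height E) (carrier E)"
proof (rule inj_onI)
  fix x y assume xy: "x \<in> carrier E" "y \<in> carrier E" "height E x = height E y"
  from xy(1,2) show "x = y"
    by (cases rule: selective_cases) (use xy height_strict_mono in \<open>metis less_irrefl\<close>)+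
qed

lemma height_add:
  assumes "x \<in> carrier E" "y \<in> carrier E"
  shows "height E (x \<oplus> y) = max (height E x) (height E y)"
  using assms
proof (cases rule: selective_cases)
  case 1
  with assms height_mono[of x y] show ?thesis by simp
next
  case 2
  with assms height_mono[of y x] show ?thesis by (simp add: a_comm)
qed

lemma height_zero [simp]: "height E \<zero> = 0"
proof -
  have none: "{y \<in> carrier E - {\<zero>}. \<zero> \<oplus> y = \<zero>} = {}" by auto
  show ?thesis unfolding height_def none by simp
qed

text \<open>Heights are bounded by the number of non-zero elements, and an injection between finite
  sets of equal size is onto.\<close>

lemma height_bij: "bij_betw (height E) (carrier E) {..card (carrier E - {\<zero>})}"
proof -
  have "height E ` carrier E \<subseteq> {..card (carrier E - {\<zero>})}"
    unfolding height_def using fin by (intro image_subsetI, unfold atMost_iff, intro card_mono) auto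
  moreover have "card (carrier E) = Suc (card (carrier E - {\<zero>}))"
    using fin by (intro card.remove) auto
  then have "card (height E ` carrier E) = card {..card (carrier E - {\<zero>})}"
    by (simp add: card_image height_inj)
  ultimately show ?thesis
    by (simp add: bij_betw_def height_inj card_subset_eq)
qed

end

end

section \<open>The chains as semimodules\<close>

text \<open>Identifies the carrier of \<open>Bn1 n\<close> with {0..n}, the adjoined zero becoming
  the number 0; addition then becomes the maximum. No clash occurs, since the chain starts at
  1.\<close>

definition lev :: "nat option \<Rightarrow> nat" where
  "lev x = (case x of None \<Rightarrow> 0 | Some i \<Rightarrow> i)"

definition unlev :: "nat \<Rightarrow> nat option" where
  "unlev k = (if k = 0 then None else Some k)"

lemma lev_simps [simp]: "lev None = 0" "lev (Some i) = i"
  by (simp_all add: lev_def)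

lemma lev_unlev [simp]: "lev (unlev k) = k"
  by (simp add: unlev_def)

lemma carrier_chain [simp]: "carrier (chain n) = {1..n}"
  by (simp add: chain_def)

lemma carrier_Bn1: "carrier (Bn1 n) = insert None (Some ` {1..n})"
  by (simp add: Bn1_def adjoin_zero_def)

lemma zero_Bn1 [simp]: "\<zero>\<^bsub>Bn1 n\<^esub> = None"
  by (simp add: Bn1_def adjoin_zero_def)

lemma None_in_Bn1 [simp]: "None \<in> carrier (Bn1 n)"
  by (simp add: carrier_Bn1)

lemma unlev_in_Bn1 [simp]: "unlev k \<in> carrier (Bn1 n) \<longleftrightarrow> k \<le> n"
  by (auto simp: unlev_def carrier_Bn1)

lemma unlev_lev [simp]: "x \<in> carrier (Bn1 n) \<Longrightarrow> unlev (lev x) = x"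
  by (auto simp: unlev_def carrier_Bn1)

lemma lev_le: "x \<in> carrier (Bn1 n) \<Longrightarrow> lev x \<le> n"
  by (auto simp: carrier_Bn1)

lemma lev_eq_iff: "x \<in> carrier (Bn1 n) \<Longrightarrow> y \<in> carrier (Bn1 n') \<Longrightarrow> lev x = lev y \<longleftrightarrow> x = y"
  by (metis unlev_lev)

lemma finite_carrier_Bn1 [simp]: "finite (carrier (Bn1 n))"
  by (simp add: carrier_Bn1)

text \<open>The join is a choice among least upper bounds, so the maximum has to be shown to be the
  only one.\<close>

lemma join_chain:
  assumes "i \<in> {1..n}" "j \<in> {1..n}"
  shows "i \<squnion>\<^bsub>chain n\<^esub> j = max i j"
proof -
  have least: "least (chain n) l (Upper (chain n) {i, j}) \<longleftrightarrow> l = max i j" for l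
  proof
    assume l: "least (chain n) l (Upper (chain n) {i, j})"
    have "max i j \<in> Upper (chain n) {i, j}"
      using assms by (auto simp: Upper_def chain_def)
    then have "l \<le> max i j" using l by (auto simp: least_def chain_def)
    moreover have "i \<le> l" "j \<le> l"
      using l assms by (auto simp: least_def Upper_def chain_def)
    ultimately show "l = max i j" by auto
  qed (use assms in \<open>auto simp: least_def Upper_def chain_def\<close>)
  then show ?thesis by (simp add: join_def sup_def)
qed

lemma add_Bn1:
  assumes "x \<in> carrier (Bn1 n)" "y \<in> carrier (Bn1 n)"
  shows "x \<oplus>\<^bsub>Bn1 n\<^esub> y = unlev (max (lev x) (lev y))"
  using assms unfolding carrier_Bn1
  by (auto simp: Bn1_def adjoin_zero_def join_chain unlev_def)

lemma bool_semimodule_Bn1: "bool_semimodule (Bn1 n)"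
proof -
  have "abelian_monoid (Bn1 n)"
    by (rule abelian_monoidI) (auto simp: add_Bn1 lev_le ac_simps)
  moreover have "BOne \<odot>\<^bsub>Bn1 n\<^esub> x = x" "BZero \<odot>\<^bsub>Bn1 n\<^esub> x = None" for x
    by (simp_all add: Bn1_def adjoin_zero_def)
  ultimately show ?thesis
    by (simp add: bool_semimodule_def bool_semimodule_axioms_def add_Bn1)
qed

lemma selective_Bn1: "selective (Bn1 n)"
  using bool_semimodule.axioms(1)[OF bool_semimodule_Bn1]
  by (auto simp: selective_def add_Bn1 max_def)

lemma card_Bn1_nonzero: "card (carrier (Bn1 n) - {None}) = n"
  by (simp add: carrier_Bn1 insert_Diff_if card_image)

lemma height_Bn1:
  assumes "x \<in> carrier (Bn1 n)"
  shows "height (Bn1 n) x = lev x"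
proof -
  have "{y \<in> carrier (Bn1 n) - {None}. x \<oplus>\<^bsub>Bn1 n\<^esub> y = x} = Some ` {1..lev x}"
  proof -
    have "x \<oplus>\<^bsub>Bn1 n\<^esub> y = x \<longleftrightarrow> lev y \<le> lev x" if "y \<in> carrier (Bn1 n)" for y
      using assms that by (metis add_Bn1 lev_unlev max.absorb_iff1 unlev_lev)
    then show ?thesis
      using lev_le[OF assms] by (auto simp: carrier_Bn1)
  qed
  then show ?thesis by (simp add: height_def card_image)
qed

text \<open>On a chain x + y is the larger of x and y, so respecting sums amounts to respecting
  comparisons.\<close>

lemma linear_maps_Bn1_iff:
  "f \<in> linear_maps BB (Bn1 m) (Bn1 n) \<longleftrightarrow> f \<in> carrier (Bn1 m) \<rightarrow>\<^sub>E carrier (Bn1 n) \<and> f None = None \<and>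
     (\<forall>x\<in>carrier (Bn1 m). \<forall>y\<in>carrier (Bn1 m). lev x \<le> lev y \<longrightarrow> lev (f x) \<le> lev (f y))"
proof (cases "f \<in> carrier (Bn1 m) \<rightarrow>\<^sub>E carrier (Bn1 n)")
  case True
  then have f: "\<And>x. x \<in> carrier (Bn1 m) \<Longrightarrow> f x \<in> carrier (Bn1 n)" by auto
  have "(\<forall>x\<in>carrier (Bn1 m). \<forall>y\<in>carrier (Bn1 m). f (x \<oplus>\<^bsub>Bn1 m\<^esub> y) = f x \<oplus>\<^bsub>Bn1 n\<^esub> f y) \<longleftrightarrow>
    (\<forall>x\<in>carrier (Bn1 m). \<forall>y\<in>carrier (Bn1 m). lev x \<le> lev y \<longrightarrow> lev (f x) \<le> lev (f y))"
    (is "?add \<longleftrightarrow> ?mono")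
  proof (intro iffI ballI impI)
    fix x y assume *: ?add "x \<in> carrier (Bn1 m)" "y \<in> carrier (Bn1 m)" "lev x \<le> lev y"
    then have "f y = f x \<oplus>\<^bsub>Bn1 n\<^esub> f y"
      by (metis add_Bn1 max.absorb2 unlev_lev)
    also have "lev \<dots> = max (lev (f x)) (lev (f y))" using * f by (simp add: add_Bn1)
    finally show "lev (f x) \<le> lev (f y)" by simp
  next
    fix x y assume *: ?mono "x \<in> carrier (Bn1 m)" "y \<in> carrier (Bn1 m)"
    then consider "lev x \<le> lev y" "lev (f x) \<le> lev (f y)" | "lev y \<le> lev x" "lev (f y) \<le> lev (f x)"
      using linear by blast
    then show "f (x \<oplus>\<^bsub>Bn1 m\<^esub> y) = f x \<oplus>\<^bsub>Bn1 n\<^esub> f y"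
      by cases (use * f in \<open>simp_all add: add_Bn1 max.absorb1 max.absorb2 unlev_lev[OF f]\<close>)
  qed
  with True show ?thesis by (auto simp: linear_maps_BB_iff bool_semimodule_Bn1)
qed (simp add: linear_maps_BB_iff bool_semimodule_Bn1)

lemma rk_Bn1: "rk BB (Bn1 n) = enat n"
  using bool_semimodule.selective_rk[OF bool_semimodule_Bn1 selective_Bn1]
  by (simp add: card_Bn1_nonzero)

lemma free_rk_Bn1:
  assumes "n \<ge> 1"
  shows "free_rk BB (Bn1 n) = 1"
proof -
  have "Some 1 \<in> carrier (Bn1 n)" using assms by (simp add: carrier_Bn1)
  then have "carrier (Bn1 n) \<noteq> {\<zero>\<^bsub>Bn1 n\<^esub>}" by force
  then show ?thesis
    using bool_semimodule.selective_iff_free_rk[OF bool_semimodule_Bn1] selective_Bn1 by blast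
qed

lemma unique_linear_iso_Bn1:
  assumes "bool_semimodule E" "rk BB E = enat n" "free_rk BB E = 1"
  shows "\<exists>!\<phi>. \<phi> \<in> linear_isos BB E (Bn1 n)"
proof -
  interpret E: bool_semimodule E by fact
  have sel: "selective E" using E.selective_iff_free_rk assms(3) by blast
  obtain S where "finite S" "generates BB E S" using assms(2) by (rule E.rk_attained)
  \<comment> \<open>Finiteness of E is a consequence of the finite rank: the generating set misses
    at most zero.\<close>
  then have "carrier E \<subseteq> insert \<zero>\<^bsub>E\<^esub> S" using E.selective_generates[OF sel] by auto
  with \<open>finite S\<close> have fin: "finite (carrier E)" using finite_subset by blast
  have n: "card (carrier E - {\<zero>\<^bsub>E\<^esub>}) = n"
    using E.selective_rk[OF sel fin] assms(2) by simp
  have height: "bij_betw (height E) (carrier E) {..n}"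
    using E.height_bij[OF sel fin] n by simp
  then have height_le: "height E x \<le> n" if "x \<in> carrier E" for x
    using that by (auto simp: bij_betw_def)
  define \<phi> where "\<phi> = (\<lambda>x\<in>carrier E. unlev (height E x))"
  have "bij_betw unlev {..n} (carrier (Bn1 n))"
    by (rule bij_betw_byWitness[of _ lev]) (auto simp: lev_le)
  then have "bij_betw (unlev \<circ> height E) (carrier E) (carrier (Bn1 n))"
    using height by (rule bij_betw_trans[rotated])
  then have "bij_betw \<phi> (carrier E) (carrier (Bn1 n))"
    by (subst bij_betw_cong[where g = "unlev \<circ> height E"]) (auto simp: \<phi>_def)
  moreover have "\<phi> \<in> linear_maps BB E (Bn1 n)"
    by (auto simp: linear_maps_BB_iff[OF assms(1) bool_semimodule_Bn1] \<phi>_def height_le add_Bn1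
      E.height_add[OF sel fin] E.height_zero[OF sel fin] unlev_def[of 0])
  ultimately have "\<phi> \<in> linear_isos BB E (Bn1 n)" by (simp add: linear_isos_def)
  moreover have "\<psi> = \<phi>" if \<psi>: "\<psi> \<in> linear_isos BB E (Bn1 n)" for \<psi>
  proof (rule PiE_ext)
    show mem: "\<psi> \<in> carrier E \<rightarrow>\<^sub>E carrier (Bn1 n)"
      using \<psi> by (auto simp: linear_isos_def linear_maps_def)
    show "\<phi> \<in> carrier E \<rightarrow>\<^sub>E carrier (Bn1 n)" by (simp add: \<phi>_def height_le)
    fix x assume x: "x \<in> carrier E"
    then have "lev (\<psi> x) = height E x"
      using height_linear_iso[OF assms(1) bool_semimodule_Bn1 \<psi> x] height_Bn1[OF PiE_mem[OF mem x]]
      by simp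
    then show "\<psi> x = \<phi> x"
      using unlev_lev[OF PiE_mem[OF mem x]] x by (simp add: \<phi>_def)
  qed
  ultimately show ?thesis by blast
qed

section \<open>Projectivity and the projection matrix\<close>

text \<open>A lift of \<open>f\<close> along \<open>g\<close> is obtained by lifting the values of \<open>f\<close> one at a time and taking
  partial sums, which makes the lift monotone.\<close>

lemma projective_Bn1: "projective_semimodule TYPE('m) TYPE('n) BB (Bn1 n)"
  unfolding projective_semimodule_def
proof (intro conjI allI impI ballI)
  show "semimodule BB (Bn1 n)" by (simp add: semimodule_BB_iff bool_semimodule_Bn1)
next
  fix M :: "(bsf, 'm) module" and N :: "(bsf, 'n) module" and g f
  assume "semimodule BB M" "semimodule BB N"
    and g: "g \<in> linear_maps BB M N" "g ` carrier M = carrier N"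
    and f: "f \<in> linear_maps BB (Bn1 n) N"
  then interpret M: bool_semimodule M + N: bool_semimodule N by (simp_all add: semimodule_BB_iff)
  note axs = M.bool_semimodule_axioms N.bool_semimodule_axioms bool_semimodule_Bn1[of n]
  have f_mem: "f x \<in> carrier N" if "x \<in> carrier (Bn1 n)" for x
    using f that by (auto simp: linear_maps_def)
  then have "\<forall>k\<in>{..n}. \<exists>y\<in>carrier M. g y = f (unlev k)"
    using g(2) by (auto simp: image_iff set_eq_iff) (metis unlev_in_Bn1)
  then obtain m where m: "\<And>k. k \<le> n \<Longrightarrow> m k \<in> carrier M" "\<And>k. k \<le> n \<Longrightarrow> g (m k) = f (unlev k)"
    using bchoice[of "{..n}" "\<lambda>k y. y \<in> carrier M \<and> g y = f (unlev k)"] by auto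
  \<comment> \<open>The lift \<open>m 0\<close> of zero may be non-zero in M, so the partial sums
    start from the zero of M and use only the later lifts.\<close>
  define s where "s = rec_nat \<zero>\<^bsub>M\<^esub> (\<lambda>k y. y \<oplus>\<^bsub>M\<^esub> m (Suc k))"
  have s_simps: "s 0 = \<zero>\<^bsub>M\<^esub>" "s (Suc k) = s k \<oplus>\<^bsub>M\<^esub> m (Suc k)" for k
    by (simp_all add: s_def)
  have s_mem: "s k \<in> carrier M" if "k \<le> n" for k
    using that by (induction k) (simp_all add: s_simps m)
  have s_add: "s i \<oplus>\<^bsub>M\<^esub> s j = s j" if "i \<le> j" "j \<le> n" for i j
    using that
  proof (induction j rule: dec_induct)
    case (step j)
    then have "i \<le> n" "j \<le> n" "Suc j \<le> n" by auto
    then have "s i \<oplus>\<^bsub>M\<^esub> (s j \<oplus>\<^bsub>M\<^esub> m (Suc j)) = (s i \<oplus>\<^bsub>M\<^esub> s j) \<oplus>\<^bsub>M\<^esub> m (Suc j)"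
      by (simp add: M.a_assoc s_mem m)
    also have "s i \<oplus>\<^bsub>M\<^esub> s j = s j" using step by simp
    finally show ?case by (simp add: s_simps)
  qed (simp add: s_mem)
  have gs: "g (s k) = f (unlev k)" if "k \<le> n" for k
    using that
  proof (induction k)
    case 0
    then show ?case using g f axs by (simp add: s_simps unlev_def linear_maps_BB_iff)
  next
    case (Suc k)
    \<comment> \<open>The earlier value of f is absorbed: by additivity the two values sum to f at
      the larger of the two levels.\<close>
    then have "g (s (Suc k)) = f (unlev k) \<oplus>\<^bsub>N\<^esub> f (unlev (Suc k))"
      using g axs by (simp add: s_simps linear_maps_BB_iff s_mem m)
    also have "\<dots> = f (unlev k \<oplus>\<^bsub>Bn1 n\<^esub> unlev (Suc k))"
      using f axs Suc.prems by (simp add: linear_maps_BB_iff)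
    finally show ?case using Suc.prems by (simp add: add_Bn1)
  qed
  let ?h = "\<lambda>x\<in>carrier (Bn1 n). s (lev x)"
  have "s (lev (x \<oplus>\<^bsub>Bn1 n\<^esub> y)) = s (lev x) \<oplus>\<^bsub>M\<^esub> s (lev y)"
    if "x \<in> carrier (Bn1 n)" "y \<in> carrier (Bn1 n)" for x y
    using that s_add[of "lev x" "lev y"] s_add[of "lev y" "lev x"] s_mem lev_le
    by (simp add: add_Bn1 max_def M.a_comm)
  then have "?h \<in> linear_maps BB (Bn1 n) M"
    unfolding linear_maps_BB_iff[OF axs(3,1)]
    by (auto simp: s_simps s_mem lev_le add_Bn1)
  moreover have "g (?h x) = f x" if "x \<in> carrier (Bn1 n)" for x
    using that by (simp add: gs lev_le)
  ultimately show "\<exists>h\<in>linear_maps BB (Bn1 n) M. \<forall>x\<in>carrier (Bn1 n). g (h x) = f x" by blast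
qed

section \<open>Boolean matrices and initial segments\<close>

lemma bsf_plus_eq_1 [simp]: "(a::bsf) + b = 1 \<longleftrightarrow> a = 1 \<or> b = 1"
  by (cases a) (simp_all add: one_bsf_def)

lemma bsf_times_eq_1 [simp]: "(a::bsf) * b = 1 \<longleftrightarrow> a = 1 \<and> b = 1"
  by (cases a) (simp_all add: one_bsf_def)

lemma bsf_eqI: "((a::bsf) = 1 \<longleftrightarrow> b = 1) \<Longrightarrow> a = b"
  by (metis bsf_neq_0)

lemma bsf_sum_eq_1: "finite I \<Longrightarrow> (\<Sum>i\<in>I. f i) = (1::bsf) \<longleftrightarrow> (\<exists>i\<in>I. f i = 1)"
  by (induction I rule: finite_induct) simp_all

text \<open>A Boolean matrix is a relation between indices, and the product is the composition of
  relations.\<close>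

lemma bsf_mult_mat_eq_1:
  fixes A B :: "bsf mat"
  assumes "A \<in> carrier_mat n m" "B \<in> carrier_mat m l" "i < n" "j < l"
  shows "(A * B) $$ (i, j) = 1 \<longleftrightarrow> (\<exists>k<m. A $$ (i, k) = 1 \<and> B $$ (k, j) = 1)"
  using assms by (auto simp: scalar_prod_def bsf_sum_eq_1 Bex_def)

lemma bsf_mult_mat_vec_eq_1:
  fixes A :: "bsf mat"
  assumes "A \<in> carrier_mat n m" "v \<in> carrier_vec m" "i < n"
  shows "(A *\<^sub>v v) $ i = 1 \<longleftrightarrow> (\<exists>k<m. A $$ (i, k) = 1 \<and> v $ k = 1)"
  using assms by (auto simp: scalar_prod_def bsf_sum_eq_1 Bex_def)

text \<open>The first number missing from D, which exists by finiteness, bounds all of D. Supports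
  of columns and vectors are recovered from their sizes in this way.\<close>

lemma downward_closed_eq_lessThan:
  assumes "finite D" "\<And>i j. j \<in> D \<Longrightarrow> i < j \<Longrightarrow> i \<in> D"
  shows "D = {..<card D :: nat}"
proof -
  define k where "k = (LEAST k. k \<notin> D)"
  have "k \<notin> D" unfolding k_def by (rule LeastI_ex) (use assms(1) ex_new_if_finite in blast)
  then have "j < k" if "j \<in> D" for j using that assms(2)[of j k] by (metis linorder_neqE_nat)
  moreover have "j \<in> D" if "j < k" for j using that not_less_Least unfolding k_def by blast
  ultimately have "D = {..<k}" by blast
  then show ?thesis by simp
qed

text \<open>If the numbers differ, the smaller one is itself an index below n at which the two
  conditions disagree.\<close>

lemma less_iff_imp_eq:
  fixes a b n :: nat
  assumes "\<And>j. j < n \<Longrightarrow> j < a \<longleftrightarrow> j < b" "a \<le> n" "b \<le> n"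
  shows "a = b"
proof (cases a b rule: linorder_cases)
  case less
  with assms show ?thesis using assms(1)[of a] by simp
next
  case greater
  with assms show ?thesis using assms(1)[of b] by simp
qed

text \<open>The relation \<open>\<simeq>\<close> only provides a bijection compatible with sums,
  products and one; the semiring laws of both sides are therefore established separately.\<close>

lemma semiring_End:
  assumes "bool_semimodule E"
  shows "semiring (End_semiring BB E)"
proof -
  interpret bool_semimodule E by fact
  let ?R = "End_semiring BB E"
  have R: "f \<in> carrier ?R \<longleftrightarrow> f \<in> carrier E \<rightarrow>\<^sub>E carrier E \<and> f \<zero>\<^bsub>E\<^esub> = \<zero>\<^bsub>E\<^esub> \<and>
      (\<forall>x\<in>carrier E. \<forall>y\<in>carrier E. f (x \<oplus>\<^bsub>E\<^esub> y) = f x \<oplus>\<^bsub>E\<^esub> f y)" for f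
    by (simp add: End_semiring_def linear_maps_BB_iff assms)
  have ops: "f \<oplus>\<^bsub>?R\<^esub> g = (\<lambda>x\<in>carrier E. f x \<oplus>\<^bsub>E\<^esub> g x)" "f \<otimes>\<^bsub>?R\<^esub> g = compose (carrier E) f g"
    "\<zero>\<^bsub>?R\<^esub> = (\<lambda>x\<in>carrier E. \<zero>\<^bsub>E\<^esub>)" "\<one>\<^bsub>?R\<^esub> = (\<lambda>x\<in>carrier E. x)" for f g
    by (simp_all add: End_semiring_def)
  have mem: "f x \<in> carrier E" if "f \<in> carrier ?R" "x \<in> carrier E" for f x
    using that R by blast
  have ext: "f = g" if "f \<in> carrier ?R" "g \<in> carrier ?R" "\<And>x. x \<in> carrier E \<Longrightarrow> f x = g x" for f g
    using that R by (meson PiE_ext)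
  have closed: "f \<oplus>\<^bsub>?R\<^esub> g \<in> carrier ?R" "f \<otimes>\<^bsub>?R\<^esub> g \<in> carrier ?R"
    if "f \<in> carrier ?R" "g \<in> carrier ?R" for f g
    using that mem[OF that(1)] mem[OF that(2)] unfolding R ops
    by (auto simp: compose_def PiE_mem a_ac)
  have zero_one: "\<zero>\<^bsub>?R\<^esub> \<in> carrier ?R" "\<one>\<^bsub>?R\<^esub> \<in> carrier ?R"
    unfolding R ops by auto
  note val = ops compose_def mem
  show ?thesis
  proof (intro semiring.intro semiring_axioms.intro abelian_monoidI monoidI)
    fix f g h assume *: "f \<in> carrier ?R" "g \<in> carrier ?R" "h \<in> carrier ?R"
    show "f \<oplus>\<^bsub>?R\<^esub> g \<oplus>\<^bsub>?R\<^esub> h = f \<oplus>\<^bsub>?R\<^esub> (g \<oplus>\<^bsub>?R\<^esub> h)"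
      by (rule ext, intro closed *, intro closed *) (use * in \<open>simp add: val a_assoc\<close>)
    show "f \<otimes>\<^bsub>?R\<^esub> g \<otimes>\<^bsub>?R\<^esub> h = f \<otimes>\<^bsub>?R\<^esub> (g \<otimes>\<^bsub>?R\<^esub> h)"
      by (rule ext, intro closed *, intro closed *) (use * in \<open>simp add: val\<close>)
    show "(f \<oplus>\<^bsub>?R\<^esub> g) \<otimes>\<^bsub>?R\<^esub> h = f \<otimes>\<^bsub>?R\<^esub> h \<oplus>\<^bsub>?R\<^esub> g \<otimes>\<^bsub>?R\<^esub> h"
      by (rule ext, intro closed *, intro closed *) (use * in \<open>simp add: val\<close>)
    \<comment> \<open>The previous law holds pointwise by definition, whereas this one uses
      additivity of h. Likewise, f composed with the zero map is zero because f preserves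
      zero.\<close>
    show "h \<otimes>\<^bsub>?R\<^esub> (f \<oplus>\<^bsub>?R\<^esub> g) = h \<otimes>\<^bsub>?R\<^esub> f \<oplus>\<^bsub>?R\<^esub> h \<otimes>\<^bsub>?R\<^esub> g"
      by (rule ext, intro closed *, intro closed *) (use * R in \<open>simp add: val\<close>)
  next
    fix f g assume *: "f \<in> carrier ?R" "g \<in> carrier ?R"
    show "f \<oplus>\<^bsub>?R\<^esub> g = g \<oplus>\<^bsub>?R\<^esub> f"
      by (rule ext, intro closed *, intro closed *) (use * in \<open>simp add: val a_comm\<close>)
    show "f \<oplus>\<^bsub>?R\<^esub> g \<in> carrier ?R" "f \<otimes>\<^bsub>?R\<^esub> g \<in> carrier ?R"
      using closed * by blast+
  next
    fix f assume *: "f \<in> carrier ?R"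
    show "\<zero>\<^bsub>?R\<^esub> \<oplus>\<^bsub>?R\<^esub> f = f" "\<one>\<^bsub>?R\<^esub> \<otimes>\<^bsub>?R\<^esub> f = f" "f \<otimes>\<^bsub>?R\<^esub> \<one>\<^bsub>?R\<^esub> = f"
      "\<zero>\<^bsub>?R\<^esub> \<otimes>\<^bsub>?R\<^esub> f = \<zero>\<^bsub>?R\<^esub>" "f \<otimes>\<^bsub>?R\<^esub> \<zero>\<^bsub>?R\<^esub> = \<zero>\<^bsub>?R\<^esub>"
      by (rule ext; (intro closed zero_one *)?; use * R in \<open>simp add: val\<close>)+
  qed (rule zero_one)+
qed

text \<open>The products P A P are the matrices fixed by P on both sides. This set is closed under
  sums and products, and P acts on it as the unit.\<close>

lemma semiring_corner:
  fixes P :: "'a::semiring_1 mat"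
  assumes P: "P \<in> carrier_mat n n" "P * P = P"
  shows "semiring (corner_semiring n P)"
proof -
  let ?R = "corner_semiring n P"
  have ops: "A \<oplus>\<^bsub>?R\<^esub> B = A + B" "A \<otimes>\<^bsub>?R\<^esub> B = A * B" "\<zero>\<^bsub>?R\<^esub> = 0\<^sub>m n n" "\<one>\<^bsub>?R\<^esub> = P" for A B
    by (simp_all add: corner_semiring_def)
  have R: "A \<in> carrier ?R \<longleftrightarrow> A \<in> carrier_mat n n \<and> P * A = A \<and> A * P = A" for A
  proof
    assume "A \<in> carrier ?R"
    then obtain B where B: "B \<in> carrier_mat n n" "A = P * B * P"
      by (auto simp: corner_semiring_def)
    moreover have "P * (P * B * P) = (P * P) * B * P" "(P * B * P) * P = P * B * (P * P)"
      using P(1) B(1) by (simp_all add: assoc_mult_mat[of _ n n _ n _ n])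
    ultimately show "A \<in> carrier_mat n n \<and> P * A = A \<and> A * P = A" using P by auto
  next
    assume "A \<in> carrier_mat n n \<and> P * A = A \<and> A * P = A"
    then show "A \<in> carrier ?R" by (auto simp: corner_semiring_def intro!: image_eqI[of _ _ A])
  qed
  show ?thesis
    by (intro semiring.intro semiring_axioms.intro abelian_monoidI monoidI)
      (use P in \<open>auto simp: R ops assoc_mult_mat[of _ n n _ n _ n] assoc_add_mat[of _ n n]
        add_mult_distrib_mat[of _ n n] mult_add_distrib_mat[of _ n n]
        simp flip: assoc_mult_mat[of P n n _ n _ n] intro: comm_add_mat\<close>)
qed

text \<open>The matrix of the endomorphism \<open>f\<close> composed with the retraction of \<open>B\<^sup>n\<close> onto the chain of the
  vectors \<open>(1, \<dots>, 1, 0, \<dots>, 0)\<close>.\<close>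

definition endo_mat :: "nat \<Rightarrow> (nat option \<Rightarrow> nat option) \<Rightarrow> bsf mat" where
  "endo_mat n f = mat n n (\<lambda>(j, i). of_bool (j < lev (f (Some (Suc i)))))"

text \<open>The retraction itself: the upper triangular matrix with ones on and above the
  diagonal.\<close>

definition chain_proj :: "nat \<Rightarrow> bsf mat" where
  "chain_proj n = endo_mat n (\<lambda>x\<in>carrier (Bn1 n). x)"

lemma endo_mat_carrier [simp]: "endo_mat n f \<in> carrier_mat n n"
  by (simp add: endo_mat_def)

lemma endo_mat_eq_1 [simp]:
  "j < n \<Longrightarrow> i < n \<Longrightarrow> endo_mat n f $$ (j, i) = 1 \<longleftrightarrow> j < lev (f (Some (Suc i)))"
  by (simp add: endo_mat_def)

lemma Some_Suc_in_Bn1 [simp]: "Some (Suc i) \<in> carrier (Bn1 n) \<longleftrightarrow> i < n"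
  by (auto simp: carrier_Bn1)

lemma chain_proj_carrier [simp]: "chain_proj n \<in> carrier_mat n n"
  by (simp add: chain_proj_def)

lemma chain_proj_eq_1 [simp]:
  "j < n \<Longrightarrow> i < n \<Longrightarrow> chain_proj n $$ (j, i) = 1 \<longleftrightarrow> j \<le> i"
  by (auto simp: chain_proj_def)

lemma bsf_mat_eqI:
  fixes A B :: "bsf mat"
  assumes "A \<in> carrier_mat n n" "B \<in> carrier_mat n n"
    and "\<And>j i. j < n \<Longrightarrow> i < n \<Longrightarrow> A $$ (j, i) = 1 \<longleftrightarrow> B $$ (j, i) = 1"
  shows "A = B"
  using assms by (intro eq_matI) (auto intro: bsf_eqI)

lemma endo_mat_compose:
  assumes f: "f \<in> linear_maps BB (Bn1 n) (Bn1 n)" and g: "g \<in> linear_maps BB (Bn1 n) (Bn1 n)"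
  shows "endo_mat n (compose (carrier (Bn1 n)) f g) = endo_mat n f * endo_mat n g"
proof (rule bsf_mat_eqI)
  fix j i assume ji: "j < n" "i < n"
  let ?x = "g (Some (Suc i))"
  have x: "?x \<in> carrier (Bn1 n)" using g ji by (auto simp: linear_maps_def)
  have "j < lev (f ?x) \<longleftrightarrow> (\<exists>k<n. j < lev (f (Some (Suc k))) \<and> k < lev ?x)" (is "?L \<longleftrightarrow> ?R")
  proof
    assume ?L
    \<comment> \<open>This excludes \<open>None\<close> as the value \<open>?x\<close>, whose image
      would have level 0. The largest index below the level of \<open>?x\<close> is then the
      witness.\<close>
    moreover have "f None = None" using f by (simp add: linear_maps_Bn1_iff)
    ultimately obtain k where "?x = Some (Suc k)" using x by (auto simp: carrier_Bn1 gr0_conv_Suc Suc_le_eq)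
    with \<open>?L\<close> x show ?R by auto
  next
    assume ?R
    then obtain k where k: "k < n" "j < lev (f (Some (Suc k)))" "k < lev ?x" by blast
    then have "lev (f (Some (Suc k))) \<le> lev (f ?x)"
      using f x unfolding linear_maps_Bn1_iff by (simp add: Suc_le_eq)
    with k show ?L by simp
  qed
  with ji show "endo_mat n (compose (carrier (Bn1 n)) f g) $$ (j, i) = 1 \<longleftrightarrow>
      (endo_mat n f * endo_mat n g) $$ (j, i) = 1"
    by (simp add: bsf_mult_mat_eq_1[of _ n n _ n] compose_def cong: conj_cong)
qed (auto intro: mult_carrier_mat[of _ n n _ n])

lemma id_linear: "(\<lambda>x\<in>carrier (Bn1 n). x) \<in> linear_maps BB (Bn1 n) (Bn1 n)"
  by (auto simp: linear_maps_Bn1_iff)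

text \<open>An instance of the composition law, with the identity taken twice.\<close>

lemma chain_proj_idem: "chain_proj n * chain_proj n = chain_proj n"
  unfolding chain_proj_def endo_mat_compose[OF id_linear id_linear, symmetric]
  by (rule arg_cong[of _ _ "endo_mat n"]) (auto simp: compose_def)

lemma endo_mat_corner:
  assumes "f \<in> linear_maps BB (Bn1 n) (Bn1 n)"
  shows "chain_proj n * endo_mat n f * chain_proj n = endo_mat n f"
proof -
  have f: "f \<in> carrier (Bn1 n) \<rightarrow>\<^sub>E carrier (Bn1 n)" using assms by (simp add: linear_maps_def)
  let ?id = "\<lambda>x\<in>carrier (Bn1 n). x"
  have "compose (carrier (Bn1 n)) ?id f = f" "compose (carrier (Bn1 n)) f ?id = f"
    using Id_compose[of f "carrier (Bn1 n)" "carrier (Bn1 n)"] compose_Id[of f "carrier (Bn1 n)" "carrier (Bn1 n)"] f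
    by (simp_all add: PiE_def)
  then show ?thesis
    using endo_mat_compose[OF id_linear assms] endo_mat_compose[OF assms id_linear]
    by (simp add: chain_proj_def)
qed

text \<open>Column i is the indicator of the indices below the level of the value at i + 1, hence
  determines this value. The value at \<open>None\<close> is fixed by linearity.\<close>

lemma endo_mat_inj: "inj_on (endo_mat n) (linear_maps BB (Bn1 n) (Bn1 n))"
proof (rule inj_onI)
  fix f g assume fg: "f \<in> linear_maps BB (Bn1 n) (Bn1 n)" "g \<in> linear_maps BB (Bn1 n) (Bn1 n)"
    and eq: "endo_mat n f = endo_mat n g"
  have mem: "f \<in> carrier (Bn1 n) \<rightarrow>\<^sub>E carrier (Bn1 n)" "g \<in> carrier (Bn1 n) \<rightarrow>\<^sub>E carrier (Bn1 n)"
    using fg by (auto simp: linear_maps_def)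
  show "f = g"
  proof (rule PiE_ext[OF mem])
    fix x assume x: "x \<in> carrier (Bn1 n)"
    show "f x = g x"
    proof (cases x)
      case None
      with fg show ?thesis by (simp add: linear_maps_Bn1_iff)
    next
      case (Some k)
      then obtain i where i: "x = Some (Suc i)" "i < n"
        using x by (cases k) (auto simp: carrier_Bn1)
      have "j < lev (f x) \<longleftrightarrow> j < lev (g x)" if "j < n" for j
        using endo_mat_eq_1[OF that i(2), of f] endo_mat_eq_1[OF that i(2), of g] eq i(1) by simp
      moreover have "lev (f x) \<le> n" "lev (g x) \<le> n"
        using mem x by (auto intro!: lev_le)
      ultimately have "lev (f x) = lev (g x)" by (rule less_iff_imp_eq)
      then show ?thesis using mem x by (metis PiE_mem lev_eq_iff)
    qed
  qed
qed

text \<open>The factor P on the left makes the support of each column an initial segment, and the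
  factor on the right makes these segments grow with the column. Their lengths are the values of
  f.\<close>

lemma endo_mat_surj:
  assumes "A \<in> carrier_mat n n" "B = chain_proj n * A * chain_proj n"
  shows "\<exists>f\<in>linear_maps BB (Bn1 n) (Bn1 n). endo_mat n f = B"
proof -
  have B: "B \<in> carrier_mat n n" using assms by (simp add: mult_carrier_mat[of _ n n _ n])
  have B_iff: "B $$ (j, i) = 1 \<longleftrightarrow> (\<exists>l<n. (\<exists>k<n. j \<le> k \<and> A $$ (k, l) = 1) \<and> l \<le> i)"
    if "j < n" "i < n" for j i
    using that assms
    by (simp add: bsf_mult_mat_eq_1[of _ n n _ n] mult_carrier_mat[of _ n n] cong: conj_cong)
  define D where "D i = {j. j < n \<and> B $$ (j, i) = 1}" for i
  have D: "D i = {..<card (D i)}" if "i < n" for i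
  proof (rule downward_closed_eq_lessThan)
    fix j' j assume "j \<in> D i" "j' < j"
    with that show "j' \<in> D i" by (auto simp: D_def B_iff) (meson le_trans less_imp_le_nat le_less_trans)
  qed (simp add: D_def)
  have D_mono: "D i \<subseteq> D i'" if "i \<le> i'" "i' < n" for i i'
    using that unfolding D_def by (auto simp: B_iff) (meson le_trans le_less_trans)
  have card_D: "card (D i) \<le> n" for i
    using card_mono[of "{..<n}" "D i"] by (auto simp: D_def)
  \<comment> \<open>The elements 1, ..., n of the chain label the columns 0, ..., n - 1; a zero
    column gives \<open>unlev 0\<close>, which is \<open>None\<close>.\<close>
  define f where "f = (\<lambda>x\<in>carrier (Bn1 n). case x of None \<Rightarrow> None | Some i \<Rightarrow> unlev (card (D (i - 1))))"
  have "card (D (i - 1)) \<le> card (D (i' - 1))" if "i \<le> i'" "1 \<le> i" "i' \<le> n" for i i'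
    using that by (intro card_mono D_mono) (auto simp: D_def)
  then have "f \<in> linear_maps BB (Bn1 n) (Bn1 n)"
    unfolding linear_maps_Bn1_iff by (auto simp: f_def card_D split: option.splits) (auto simp: carrier_Bn1)
  moreover have "endo_mat n f = B"
  proof (rule bsf_mat_eqI[OF _ B])
    fix j i assume ji: "j < n" "i < n"
    have "j < card (D i) \<longleftrightarrow> j \<in> D i" using D[OF ji(2)] by blast
    with ji show "endo_mat n f $$ (j, i) = 1 \<longleftrightarrow> B $$ (j, i) = 1"
      by (simp add: f_def D_def)
  qed simp
  ultimately show ?thesis by blast
qed

lemma End_iso_corner: "End_semiring BB (Bn1 n) \<simeq> corner_semiring n (chain_proj n)"
proof -
  let ?L = "linear_maps BB (Bn1 n) (Bn1 n)" and ?C = "corner_semiring n (chain_proj n)"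
  have im: "endo_mat n ` ?L = carrier ?C"
  proof
    show "endo_mat n ` ?L \<subseteq> carrier ?C"
    proof (rule image_subsetI)
      fix f assume "f \<in> ?L"
      then show "endo_mat n f \<in> carrier ?C"
        unfolding corner_semiring_def using endo_mat_corner[of f n]
        by (auto intro!: image_eqI[of _ _ "endo_mat n f"])
    qed
    show "carrier ?C \<subseteq> endo_mat n ` ?L"
    proof
      fix B assume "B \<in> carrier ?C"
      then obtain A where "A \<in> carrier_mat n n" "B = chain_proj n * A * chain_proj n"
        by (auto simp: corner_semiring_def)
      from endo_mat_surj[OF this] show "B \<in> endo_mat n ` ?L" by blast
    qed
  qed
  \<comment> \<open>Sums of maps take the larger level, and j lies below a maximum iff it lies below
    one of the two numbers: this is the entrywise Boolean sum.\<close>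
  have "endo_mat n (\<lambda>x\<in>carrier (Bn1 n). f x \<oplus>\<^bsub>Bn1 n\<^esub> g x) = endo_mat n f + endo_mat n g"
    if "f \<in> ?L" "g \<in> ?L" for f g
  proof (rule bsf_mat_eqI)
    fix j i assume ji: "j < n" "i < n"
    have "f (Some (Suc i)) \<in> carrier (Bn1 n)" "g (Some (Suc i)) \<in> carrier (Bn1 n)"
      using that ji by (auto simp: linear_maps_def)
    with ji show "endo_mat n (\<lambda>x\<in>carrier (Bn1 n). f x \<oplus>\<^bsub>Bn1 n\<^esub> g x) $$ (j, i) = 1 \<longleftrightarrow>
        (endo_mat n f + endo_mat n g) $$ (j, i) = 1"
      by (auto simp: add_Bn1 index_add_mat(1)[of _ "endo_mat n g"] carrier_matD[OF endo_mat_carrier])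
  qed auto
  moreover note endo_mat_compose
  ultimately have "endo_mat n \<in> Ring.ring_hom (End_semiring BB (Bn1 n)) ?C"
    using im by (intro ring_hom_memI)
      (auto simp: End_semiring_def corner_semiring_def chain_proj_def)
  moreover have "bij_betw (endo_mat n) (carrier (End_semiring BB (Bn1 n))) (carrier ?C)"
    using im endo_mat_inj by (simp add: bij_betw_def End_semiring_def)
  ultimately show ?thesis by (auto simp: is_ring_iso_def ring_iso_def)
qed

section \<open>The range of the projection\<close>

definition lev_vec :: "nat \<Rightarrow> nat option \<Rightarrow> bsf vec" where
  "lev_vec n x = vec n (\<lambda>j. of_bool (j < lev x))"

lemma lev_vec_carrier [simp]: "lev_vec n x \<in> carrier_vec n"
  by (simp add: lev_vec_def)

lemma lev_vec_eq_1 [simp]: "j < n \<Longrightarrow> lev_vec n x $ j = 1 \<longleftrightarrow> j < lev x"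
  by (simp add: lev_vec_def)

lemma bsf_vec_eqI:
  fixes v w :: "bsf vec"
  assumes "v \<in> carrier_vec n" "w \<in> carrier_vec n" "\<And>j. j < n \<Longrightarrow> v $ j = 1 \<longleftrightarrow> w $ j = 1"
  shows "v = w"
  using assms by (intro eq_vecI) (auto intro: bsf_eqI)

text \<open>The vectors \<open>lev_vec n x\<close> are fixed by the projection. Conversely, the
  support of a projected vector is an initial segment, whose length is the required level.\<close>

lemma lev_vec_image:
  "lev_vec n ` carrier (Bn1 n) = (\<lambda>v. chain_proj n *\<^sub>v v) ` carrier_vec n"
proof (intro subset_antisym image_subsetI)
  fix x assume x: "x \<in> carrier (Bn1 n)"
  have "lev_vec n x = chain_proj n *\<^sub>v lev_vec n x"
  proof (rule bsf_vec_eqI)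
    fix j assume j: "j < n"
    have "j < lev x \<longleftrightarrow> (\<exists>k<n. j \<le> k \<and> k < lev x)" using j by auto
    with j show "lev_vec n x $ j = 1 \<longleftrightarrow> (chain_proj n *\<^sub>v lev_vec n x) $ j = 1"
      by (simp add: bsf_mult_mat_vec_eq_1[of _ n n] cong: conj_cong)
  qed (auto intro: mult_mat_vec_carrier[of _ n n])
  then show "lev_vec n x \<in> (\<lambda>v. chain_proj n *\<^sub>v v) ` carrier_vec n" by (rule image_eqI) simp
next
  fix v :: "bsf vec" assume v: "v \<in> carrier_vec n"
  define D where "D = {j. j < n \<and> (\<exists>k<n. j \<le> k \<and> v $ k = 1)}"
  have D: "D = {..<card D}"
    by (rule downward_closed_eq_lessThan) (auto simp: D_def intro: less_imp_le_nat less_le_trans)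
  have "chain_proj n *\<^sub>v v = lev_vec n (unlev (card D))"
  proof (rule bsf_vec_eqI)
    fix j assume j: "j < n"
    have "j \<in> D \<longleftrightarrow> j < card D" using D by blast
    with j v show "(chain_proj n *\<^sub>v v) $ j = 1 \<longleftrightarrow> lev_vec n (unlev (card D)) $ j = 1"
      by (simp add: bsf_mult_mat_vec_eq_1[of _ n n] D_def cong: conj_cong)
  qed (use v in \<open>auto intro: mult_mat_vec_carrier[of _ n n]\<close>)
  moreover have "card D \<le> n" using card_mono[of "{..<n}" D] by (auto simp: D_def)
  ultimately show "chain_proj n *\<^sub>v v \<in> lev_vec n ` carrier (Bn1 n)" by simp
qed

lemma mat_range_iso: "linear_isos BB (Bn1 n) (mat_range n (chain_proj n)) \<noteq> {}"
proof -
  let ?F = "mat_range n (chain_proj n)"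
  have F: "carrier ?F = lev_vec n ` carrier (Bn1 n)" "u \<oplus>\<^bsub>?F\<^esub> v = u + v" "a \<odot>\<^bsub>?F\<^esub> v = a \<cdot>\<^sub>v v" for u v a
    by (simp_all add: mat_range_def module_vec_def lev_vec_image)
  define \<phi> where "\<phi> = (\<lambda>x\<in>carrier (Bn1 n). lev_vec n x)"
  have "inj_on (lev_vec n) (carrier (Bn1 n))"
  proof (rule inj_onI)
    fix x y assume xy: "x \<in> carrier (Bn1 n)" "y \<in> carrier (Bn1 n)" "lev_vec n x = lev_vec n y"
    then have "j < lev x \<longleftrightarrow> j < lev y" if "j < n" for j
      using lev_vec_eq_1[OF that, of x] lev_vec_eq_1[OF that, of y] by simp
    then have "lev x = lev y"
      using lev_le[OF xy(1)] lev_le[OF xy(2)] by (rule less_iff_imp_eq)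
    with xy show "x = y" by (simp add: lev_eq_iff)
  qed
  then have "bij_betw \<phi> (carrier (Bn1 n)) (carrier ?F)"
    by (simp add: F bij_betw_def \<phi>_def inj_on_def)
  moreover have "lev_vec n (x \<oplus>\<^bsub>Bn1 n\<^esub> y) = lev_vec n x + lev_vec n y"
    if "x \<in> carrier (Bn1 n)" "y \<in> carrier (Bn1 n)" for x y
    by (rule bsf_vec_eqI[of _ n]) (use that in \<open>auto simp: add_Bn1 lev_vec_def\<close>)
  moreover have "a \<odot>\<^bsub>Bn1 n\<^esub> x = (if a = 1 then x else None)" for a x
    by (cases a) (simp_all add: Bn1_def adjoin_zero_def one_bsf_def)
  then have "lev_vec n (a \<odot>\<^bsub>Bn1 n\<^esub> x) = a \<cdot>\<^sub>v lev_vec n x" for a x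
    by (intro bsf_vec_eqI[of _ n]) (auto simp: lev_vec_def)
  \<comment> \<open>Closure of the carrier matters because \<phi> agrees with
    \<open>lev_vec n\<close> only there.\<close>
  moreover have "semimodule BB (Bn1 n)" by (simp add: semimodule_BB_iff bool_semimodule_Bn1)
  then have "x \<oplus>\<^bsub>Bn1 n\<^esub> y \<in> carrier (Bn1 n)" "a \<odot>\<^bsub>Bn1 n\<^esub> x \<in> carrier (Bn1 n)"
    if "x \<in> carrier (Bn1 n)" "y \<in> carrier (Bn1 n)" for a x y
    using that by (auto simp: semimodule_def abelian_monoid.a_closed)
  ultimately have "\<phi> \<in> linear_isos BB (Bn1 n) ?F"
    by (auto simp: linear_isos_def linear_maps_def F \<phi>_def)
  then show ?thesis by blast
qed

section \<open>The category of semimodules and the simplicial category\<close>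

lemma semifield_endos_BB: "semifield_endos BB = {\<lambda>a. a}"
proof -
  have "\<sigma> = (\<lambda>a. a)" if "\<sigma> BZero = BZero" "\<sigma> BOne = BOne" for \<sigma>
  proof
    fix a show "\<sigma> a = a" by (cases a) (simp_all add: that)
  qed
  moreover have "\<sigma> BZero = BZero" "\<sigma> BOne = BOne" if "\<sigma> \<in> semifield_endos BB" for \<sigma>
    using that ring_hom_one[of \<sigma> BB BB] by (simp_all add: semifield_endos_def)
  moreover have "(\<lambda>a. a) \<in> semifield_endos BB"
    by (simp add: semifield_endos_def Ring.ring_hom_def)
  ultimately show ?thesis by blast
qed

lemma semilinear_maps_BB: "semilinear_maps BB E F = linear_maps BB E F"
  by (auto simp: semilinear_maps_def linear_maps_def semifield_endos_BB)

lemma projective_class_BB: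
  assumes "bool_semimodule F" "f \<in> carrier E \<rightarrow>\<^sub>E carrier F"
  shows "projective_class BB E F f = {f}"
proof -
  have "(\<lambda>x\<in>carrier E. BOne \<odot>\<^bsub>F\<^esub> f x) = f"
    using PiE_mem[OF assms(2)] bool_semimodule.smult_BOne[OF assms(1)]
    by (intro PiE_ext[OF _ assms(2)]) auto
  then show ?thesis by (auto simp: projective_class_def)
qed

text \<open>Representatives of the morphisms: the hom-sets consist of the singletons of these
  maps.\<close>

definition kernel_free_maps ::
    "(bsf, 'e, 'y) module_scheme \<Rightarrow> (bsf, 'f, 'z) module_scheme \<Rightarrow> ('e \<Rightarrow> 'f) set" where
  "kernel_free_maps E F = {f \<in> linear_maps BB E F. zero_kernel E F f}"

lemma kernel_free_maps_iff:
  assumes "bool_semimodule E" "bool_semimodule F"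
  shows "f \<in> kernel_free_maps E F \<longleftrightarrow> f \<in> carrier E \<rightarrow>\<^sub>E carrier F \<and>
    (\<forall>x\<in>carrier E. f x = \<zero>\<^bsub>F\<^esub> \<longleftrightarrow> x = \<zero>\<^bsub>E\<^esub>) \<and>
    (\<forall>x\<in>carrier E. \<forall>y\<in>carrier E. f (x \<oplus>\<^bsub>E\<^esub> y) = f x \<oplus>\<^bsub>F\<^esub> f y)"
proof -
  interpret E: bool_semimodule E by fact
  show ?thesis
    unfolding kernel_free_maps_def linear_maps_BB_iff[OF assms] mem_Collect_eq zero_kernel_def
    using E.zero_closed by (auto simp: set_eq_iff)
qed

lemma Hom_proj_category_BB:
  assumes "semimodule BB E" "semimodule BB F"
  shows "Hom (proj_category BB) E F = (\<lambda>f. {f}) ` kernel_free_maps E F"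
proof -
  have "projective_class BB E F f = {f}" if "f \<in> kernel_free_maps E F" for f
    using that assms by (intro projective_class_BB)
      (auto simp: kernel_free_maps_def linear_maps_def semimodule_BB_iff)
  then show ?thesis
    by (simp add: proj_category_def semilinear_maps_BB flip: kernel_free_maps_def)
qed

lemma (in bool_semimodule) kernel_free_id: "(\<lambda>x\<in>carrier E. x) \<in> kernel_free_maps E E"
  by (simp add: kernel_free_maps_iff bool_semimodule_axioms)

lemma kernel_free_compose:
  assumes "bool_semimodule E" "bool_semimodule F" "bool_semimodule G"
    and "f \<in> kernel_free_maps E F" "g \<in> kernel_free_maps F G"
  shows "compose (carrier E) g f \<in> kernel_free_maps E G"
proof -
  interpret E: bool_semimodule E by fact
  have "f x \<in> carrier F" if "x \<in> carrier E" for x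
    using assms that by (auto simp: kernel_free_maps_iff)
  with assms show ?thesis by (auto simp: kernel_free_maps_iff compose_def PiE_mem)
qed

lemma Idn_proj_category_BB:
  "bool_semimodule E \<Longrightarrow> Idn (proj_category BB) E = {\<lambda>x\<in>carrier E. x}"
  by (simp add: proj_category_def projective_class_BB)

lemma Comp_proj_category:
  "Comp (proj_category K) E F G {g} {f} = {compose (carrier E) g f}"
  by (auto simp: proj_category_def)

lemma compose_id_PiE:
  assumes "f \<in> X \<rightarrow>\<^sub>E Y"
  shows "compose X f (\<lambda>x\<in>X. x) = f" "compose X (\<lambda>x\<in>Y. x) f = f"
  using assms compose_Id[of f X Y] Id_compose[of f X Y] by (simp_all add: PiE_def)

lemma category_full_subcategory:
  assumes "category C" "S \<subseteq> Obj C"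
  shows "category (full_subcategory C S)"
  using assms(1) unfolding category_def full_subcategory_def
  by (simp add: subsetD[OF assms(2)])

text \<open>Composition of singleton classes is composition of their elements, so the laws reduce to
  those of \<open>compose\<close> on extensional functions.\<close>

lemma category_proj_category_BB: "category (proj_category BB)"
proof -
  let ?C = "proj_category BB :: ((bsf, 'e) module, _) cat"
  have Obj: "Obj ?C = {E. bool_semimodule E}" by (simp add: proj_category_def semimodule_BB_iff)
  have Hom: "Hom ?C E F = (\<lambda>f. {f}) ` kernel_free_maps E F"
    if "bool_semimodule E" "bool_semimodule F" for E F
    using that by (simp add: Hom_proj_category_BB semimodule_BB_iff)
  have mem: "f \<in> carrier E \<rightarrow>\<^sub>E carrier F" if "f \<in> kernel_free_maps E F" for f and E F :: "(bsf, 'e) module"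
    using that by (simp add: kernel_free_maps_def linear_maps_def)
  show ?thesis
    unfolding category_def Obj
  proof (intro conjI ballI; simp only: mem_Collect_eq)
    fix E :: "(bsf, 'e) module" assume "bool_semimodule E"
    then show "Idn ?C E \<in> Hom ?C E E" by (simp add: Hom Idn_proj_category_BB bool_semimodule.kernel_free_id)
  next
    fix E F G :: "(bsf, 'e) module" and f g
    assume "bool_semimodule E" "bool_semimodule F" "bool_semimodule G" "f \<in> Hom ?C E F" "g \<in> Hom ?C F G"
    then show "Comp ?C E F G g f \<in> Hom ?C E G"
      by (auto simp: Hom Comp_proj_category intro: kernel_free_compose)
  next
    fix E F :: "(bsf, 'e) module" and f assume *: "bool_semimodule E" "bool_semimodule F" "f \<in> Hom ?C E F"
    then obtain f' where "f = {f'}" "f' \<in> kernel_free_maps E F" by (auto simp: Hom)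
    moreover from mem[OF this(2)] have "f' \<in> carrier E \<rightarrow>\<^sub>E carrier F" .
    ultimately show "Comp ?C E E F f (Idn ?C E) = f" "Comp ?C E F F (Idn ?C F) f = f"
      by (simp_all add: compose_id_PiE * Idn_proj_category_BB Comp_proj_category)
  next
    fix D E F G :: "(bsf, 'e) module" and f g h
    assume "bool_semimodule D" "bool_semimodule E" "bool_semimodule F" "bool_semimodule G"
      "f \<in> Hom ?C D E" "g \<in> Hom ?C E F" "h \<in> Hom ?C F G"
    then obtain f' g' h' where f: "f = {f'}" "g = {g'}" "h = {h'}" "f' \<in> kernel_free_maps D E"
      by (auto simp: Hom)
    have "compose (carrier D) (compose (carrier E) h' g') f' = compose (carrier D) h' (compose (carrier D) g' f')"
      using mem[OF f(4)] by (intro compose_assoc[symmetric]) (simp add: PiE_def)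
    then show "Comp ?C D E G (Comp ?C E F G h g) f = Comp ?C D F G h (Comp ?C D E F g f)"
      by (simp add: f Comp_proj_category)
  qed
qed

section \<open>The simplicial category and the extension by zero\<close>

lemma category_simplicial: "category simplicial_category"
proof -
  have Hom: "Hom simplicial_category X Y = {f \<in> X \<rightarrow>\<^sub>E Y. mono_on X f}" for X Y
    by (simp add: simplicial_category_def)
  have Idn: "Idn simplicial_category X = (\<lambda>x\<in>X. x)"
    and Comp: "Comp simplicial_category X Y Z = compose X" for X Y Z
    by (simp_all add: simplicial_category_def)
  show ?thesis
    unfolding category_def Hom Idn Comp
  proof (intro conjI ballI)
    fix X Y Z :: "nat set" and f g :: "nat \<Rightarrow> nat"
    assume f: "f \<in> {f \<in> X \<rightarrow>\<^sub>E Y. mono_on X f}" and g: "g \<in> {g \<in> Y \<rightarrow>\<^sub>E Z. mono_on Y g}"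
    have "f x \<in> Y" if "x \<in> X" for x using f that by auto
    with f g show "compose X g f \<in> {f \<in> X \<rightarrow>\<^sub>E Z. mono_on X f}"
      by (auto simp: compose_def monotone_on_def)
  next
    fix W X :: "nat set" and f g h :: "nat \<Rightarrow> nat"
    assume "f \<in> {f \<in> W \<rightarrow>\<^sub>E X. mono_on W f}"
    then show "compose W (compose X h g) f = compose W h (compose W g f)"
      by (intro compose_assoc[symmetric]) (simp add: PiE_def)
  qed (auto simp: compose_id_PiE monotone_on_def)
qed

lemma extend_zero_atLeastAtMost:
  "extend_zero {0..m} f = (\<lambda>x\<in>carrier (Bn1 (Suc m)). map_option (\<lambda>i. Suc (f (i - 1))) x)"
  by (simp add: extend_zero_def carrier_Bn1)

lemma kernel_free_maps_Bn1_iff: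
  "g \<in> kernel_free_maps (Bn1 m) (Bn1 n) \<longleftrightarrow> g \<in> carrier (Bn1 m) \<rightarrow>\<^sub>E carrier (Bn1 n) \<and>
     (\<forall>x\<in>carrier (Bn1 m). g x = None \<longleftrightarrow> x = None) \<and>
     (\<forall>x\<in>carrier (Bn1 m). \<forall>y\<in>carrier (Bn1 m). lev x \<le> lev y \<longrightarrow> lev (g x) \<le> lev (g y))"
  unfolding kernel_free_maps_def linear_maps_Bn1_iff mem_Collect_eq zero_kernel_def
  by (auto simp: set_eq_iff)

text \<open>By the kernel condition a map is given by its restriction to the non-zero elements,
  whose values are again non-zero; undoing the shift by one inverts the extension.\<close>

lemma extend_zero_bij:
  "bij_betw (extend_zero {0..m}) {f \<in> {0..m} \<rightarrow>\<^sub>E {0..n}. mono_on {0..m} f}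
     (kernel_free_maps (Bn1 (Suc m)) (Bn1 (Suc n)))"
proof (rule bij_betw_byWitness[of _ "\<lambda>g. \<lambda>i\<in>{0..m}. lev (g (Some (Suc i))) - 1"])
  show "\<forall>f\<in>{f \<in> {0..m} \<rightarrow>\<^sub>E {0..n}. mono_on {0..m} f}.
      (\<lambda>i\<in>{0..m}. lev (extend_zero {0..m} f (Some (Suc i))) - 1) = f"
  proof (intro ballI, clarify)
    fix f assume f: "f \<in> {0..m} \<rightarrow>\<^sub>E {0..n}"
    show "(\<lambda>i\<in>{0..m}. lev (extend_zero {0..m} f (Some (Suc i))) - 1) = f"
      by (rule PiE_ext[OF _ f]) (use f in \<open>auto simp: extend_zero_atLeastAtMost less_Suc_eq_le\<close>)
  qed
next
  show "\<forall>g\<in>kernel_free_maps (Bn1 (Suc m)) (Bn1 (Suc n)).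
      extend_zero {0..m} (\<lambda>i\<in>{0..m}. lev (g (Some (Suc i))) - 1) = g"
  proof
    fix g assume g: "g \<in> kernel_free_maps (Bn1 (Suc m)) (Bn1 (Suc n))"
    then have g_mem: "g \<in> carrier (Bn1 (Suc m)) \<rightarrow>\<^sub>E carrier (Bn1 (Suc n))"
      and g_None: "\<And>x. x \<in> carrier (Bn1 (Suc m)) \<Longrightarrow> g x = None \<longleftrightarrow> x = None"
      unfolding kernel_free_maps_Bn1_iff by simp_all
    show "extend_zero {0..m} (\<lambda>i\<in>{0..m}. lev (g (Some (Suc i))) - 1) = g"
    proof
      fix x
      have "x \<notin> carrier (Bn1 (Suc m)) \<or> x = None \<or> (\<exists>i\<le>m. x = Some (Suc i))"
        by (cases x; cases "the x") (auto simp: carrier_Bn1)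
      then consider "x \<notin> carrier (Bn1 (Suc m))" | "x = None" | i where "x = Some (Suc i)" "i \<le> m"
        by blast
      then show "extend_zero {0..m} (\<lambda>i\<in>{0..m}. lev (g (Some (Suc i))) - 1) x = g x"
      proof cases
        case 1
        with g_mem have "g x = undefined" by (rule PiE_arb)
        with 1 show ?thesis by (simp add: extend_zero_atLeastAtMost)
      next
        case 2
        with g_None[of None] show ?thesis by (simp add: extend_zero_atLeastAtMost)
      next
        case 3
        then have "x \<in> carrier (Bn1 (Suc m))" by simp
        \<comment> \<open>The level of a value other than \<open>None\<close> is at least 1, so the
          truncated subtraction of 1 can be undone.\<close>
        then have "g x \<in> carrier (Bn1 (Suc n))" "g x \<noteq> None"
          using PiE_mem[OF g_mem] g_None 3 by auto
        with 3 show ?thesis by (auto simp: extend_zero_atLeastAtMost carrier_Bn1)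
      qed
    qed
  qed
next
  show "extend_zero {0..m} ` {f \<in> {0..m} \<rightarrow>\<^sub>E {0..n}. mono_on {0..m} f} \<subseteq>
      kernel_free_maps (Bn1 (Suc m)) (Bn1 (Suc n))"
  proof (intro image_subsetI, clarify)
    fix f assume f: "f \<in> {0..m} \<rightarrow>\<^sub>E {0..n}" "mono_on {0..m} f"
    have "f (i - Suc 0) \<le> n" if "1 \<le> i" "i \<le> Suc m" for i
      using PiE_mem[OF f(1), of "i - 1"] that by auto
    moreover have "f (i - Suc 0) \<le> f (j - Suc 0)" if "1 \<le> i" "i \<le> j" "j \<le> Suc m" for i j
      using f(2) that by (auto simp: monotone_on_def)
    ultimately show "extend_zero {0..m} f \<in> kernel_free_maps (Bn1 (Suc m)) (Bn1 (Suc n))"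
      unfolding kernel_free_maps_Bn1_iff by (auto simp: extend_zero_atLeastAtMost carrier_Bn1)
  qed
next
  show "(\<lambda>g. \<lambda>i\<in>{0..m}. lev (g (Some (Suc i))) - 1) ` kernel_free_maps (Bn1 (Suc m)) (Bn1 (Suc n)) \<subseteq>
      {f \<in> {0..m} \<rightarrow>\<^sub>E {0..n}. mono_on {0..m} f}"
  proof (intro image_subsetI)
    fix g assume g: "g \<in> kernel_free_maps (Bn1 (Suc m)) (Bn1 (Suc n))"
    then have g_mem: "g \<in> carrier (Bn1 (Suc m)) \<rightarrow>\<^sub>E carrier (Bn1 (Suc n))"
      by (simp add: kernel_free_maps_Bn1_iff)
    have "lev (g (Some (Suc i))) - 1 \<le> n" if "i \<le> m" for i
      using lev_le[OF PiE_mem[OF g_mem, of "Some (Suc i)"]] that by simp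
    moreover have "lev (g (Some (Suc i))) \<le> lev (g (Some (Suc j)))" if "i \<le> j" "j \<le> m" for i j
      using g that by (auto simp: kernel_free_maps_Bn1_iff)
    ultimately show "(\<lambda>i\<in>{0..m}. lev (g (Some (Suc i))) - 1) \<in> {f \<in> {0..m} \<rightarrow>\<^sub>E {0..n}. mono_on {0..m} f}"
      by (auto simp: monotone_on_def intro!: diff_le_mono)
  qed
qed

lemma simplicial_category_iso:
  "category_iso simplicial_category (full_subcategory (proj_category BB) (Bn1 ` {1..}))
     (\<lambda>X. Bn1 (card X))
     (\<lambda>X Y f. projective_class BB (Bn1 (card X)) (Bn1 (card Y)) (extend_zero X f))"
proof -
  let ?D = "full_subcategory (proj_category BB) (Bn1 ` {1..})"
  let ?H = "\<lambda>m n. {f \<in> {0..m} \<rightarrow>\<^sub>E {0..n}. mono_on {0..m} f} :: (nat \<Rightarrow> nat) set"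
  have semi: "semimodule BB (Bn1 n)" for n by (simp add: semimodule_BB_iff bool_semimodule_Bn1)
  have cat: "category ?D"
    using semi by (intro category_full_subcategory[OF category_proj_category_BB]) (auto simp: proj_category_def)
  have ObjS: "Obj simplicial_category = range (\<lambda>n. {0..n})"
    and HomS: "Hom simplicial_category {0..m} {0..n} = ?H m n" for m n
    by (simp_all add: simplicial_category_def)
  have IdnS: "Idn simplicial_category X = (\<lambda>x\<in>X. x)"
    and CompS: "Comp simplicial_category X Y Z = compose X" for X Y Z
    by (simp_all add: simplicial_category_def)
  have HomD: "Hom ?D (Bn1 m) (Bn1 n) = (\<lambda>f. {f}) ` kernel_free_maps (Bn1 m) (Bn1 n)" for m n
    using Hom_proj_category_BB[OF semi semi] by (simp add: full_subcategory_def)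
  have ext_mem: "extend_zero {0..m} f \<in> kernel_free_maps (Bn1 (Suc m)) (Bn1 (Suc n))"
    if "f \<in> ?H m n" for m n f
    using extend_zero_bij[of m n] that by (auto simp: bij_betw_def)
  have pc: "projective_class BB (Bn1 (Suc m)) (Bn1 (Suc n)) (extend_zero {0..m} f) = {extend_zero {0..m} f}"
    if "f \<in> ?H m n" for m n f
    using ext_mem[OF that] by (intro projective_class_BB bool_semimodule_Bn1) (simp add: kernel_free_maps_Bn1_iff)
  \<comment> \<open>The objects are the structures themselves, not isomorphism classes; their
    numbers of non-zero elements tell them apart.\<close>
  have inj: "inj Bn1"
    by (rule inj_onI) (metis card_Bn1_nonzero)
  have bij_Obj: "bij_betw (\<lambda>X. Bn1 (card X)) (range (\<lambda>n::nat. {0..n})) (Bn1 ` {1..})"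
  proof (rule bij_betw_imageI)
    show "inj_on (\<lambda>X. Bn1 (card X)) (range (\<lambda>n::nat. {0..n}))"
      using inj by (auto simp: inj_on_def)
    have "{1..} = range Suc" by (auto simp: image_iff Suc_le_eq gr0_conv_Suc)
    then show "(\<lambda>X. Bn1 (card X)) ` range (\<lambda>n::nat. {0..n}) = Bn1 ` {1..}"
      by (simp add: image_image)
  qed
  have bij_Hom: "bij_betw (\<lambda>f. projective_class BB (Bn1 (Suc m)) (Bn1 (Suc n)) (extend_zero {0..m} f))
      (?H m n) ((\<lambda>f. {f}) ` kernel_free_maps (Bn1 (Suc m)) (Bn1 (Suc n)))" for m n
  proof -
    have "bij_betw (\<lambda>f. {f}) (kernel_free_maps (Bn1 (Suc m)) (Bn1 (Suc n)))
        ((\<lambda>f. {f}) ` kernel_free_maps (Bn1 (Suc m)) (Bn1 (Suc n)))"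
      by (simp add: bij_betw_def)
    from bij_betw_trans[OF extend_zero_bij this] show ?thesis
      by (subst bij_betw_cong[where g = "(\<lambda>f. {f}) \<circ> extend_zero {0..m}"]) (simp_all add: pc)
  qed
  have id: "extend_zero {0..m} (\<lambda>x\<in>{0..m}. x) = (\<lambda>x\<in>carrier (Bn1 (Suc m)). x)" for m
    by (auto simp: extend_zero_atLeastAtMost carrier_Bn1 fun_eq_iff)
  have comp: "extend_zero {0..l} (compose {0..l} g f) =
      compose (carrier (Bn1 (Suc l))) (extend_zero {0..m} g) (extend_zero {0..l} f)"
    if "f \<in> ?H l m" for l m f g
  proof -
    \<comment> \<open>The values of f must stay within {0..m}, since the extension of g is
      \<open>undefined\<close> outside its carrier.\<close>
    have "f (i - Suc 0) \<le> m" if "1 \<le> i" "i \<le> Suc l" for i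
      using PiE_mem[of f "{0..l}" "\<lambda>_. {0..m}" "i - 1"] \<open>f \<in> ?H l m\<close> that by auto
    then have "extend_zero {0..l} (compose {0..l} g f) x =
        compose (carrier (Bn1 (Suc l))) (extend_zero {0..m} g) (extend_zero {0..l} f) x" for x
      by (cases x) (auto simp: extend_zero_atLeastAtMost carrier_Bn1 compose_def)
    then show ?thesis by (rule ext)
  qed
  have comp_mem: "compose {0..l} g f \<in> ?H l n" if "f \<in> ?H l m" "g \<in> ?H m n" for l m n f g
  proof -
    have "\<forall>X\<in>range (\<lambda>n. {0..n}). \<forall>Y\<in>range (\<lambda>n. {0..n}). \<forall>Z\<in>range (\<lambda>n. {0..n}).
        \<forall>f\<in>Hom simplicial_category X Y. \<forall>g\<in>Hom simplicial_category Y Z.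
          compose X g f \<in> Hom simplicial_category X Z"
      using category_simplicial unfolding category_def ObjS CompS by (elim conjE)
    from this[rule_format, OF rangeI rangeI rangeI, unfolded HomS, OF that] show ?thesis .
  qed
  have "(\<lambda>x\<in>{0..m}. x) \<in> ?H m m" for m by (auto simp: monotone_on_def)
  note pc_id = pc[OF this, unfolded id]
  have IdnD: "Idn ?D (Bn1 n) = {\<lambda>x\<in>carrier (Bn1 n). x}" for n
    by (simp add: full_subcategory_def Idn_proj_category_BB bool_semimodule_Bn1)
  have CompD: "Comp ?D E F G {g} {f} = {compose (carrier E) g f}" for E F G f g
    by (simp add: full_subcategory_def Comp_proj_category)
  have ObjD: "Obj ?D = Bn1 ` {1..}" by (simp add: full_subcategory_def)
  show ?thesis
    unfolding category_iso_def ObjS ObjD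
  proof (intro conjI ballI cat category_simplicial bij_Obj; (elim rangeE)?; hypsubst)
    fix m n
    show "bij_betw (\<lambda>f. projective_class BB (Bn1 (card {0..m})) (Bn1 (card {0..n})) (extend_zero {0..m} f))
        (Hom simplicial_category {0..m} {0..n}) (Hom ?D (Bn1 (card {0..m})) (Bn1 (card {0..n})))"
      using bij_Hom unfolding HomS HomD by simp
  next
    fix m
    show "projective_class BB (Bn1 (card {0..m})) (Bn1 (card {0..m}))
        (extend_zero {0..m} (Idn simplicial_category {0..m})) = Idn ?D (Bn1 (card {0..m}))"
      using pc_id unfolding IdnS IdnD id by simp
  next
    fix f g l m n
    assume f: "f \<in> Hom simplicial_category {0..l} {0..m}" and g: "g \<in> Hom simplicial_category {0..m} {0..n}"
    show "projective_class BB (Bn1 (card {0..l})) (Bn1 (card {0..n}))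
        (extend_zero {0..l} (Comp simplicial_category {0..l} {0..m} {0..n} g f)) =
      Comp ?D (Bn1 (card {0..l})) (Bn1 (card {0..m})) (Bn1 (card {0..n}))
        (projective_class BB (Bn1 (card {0..m})) (Bn1 (card {0..n})) (extend_zero {0..m} g))
        (projective_class BB (Bn1 (card {0..l})) (Bn1 (card {0..m})) (extend_zero {0..l} f))"
      using pc[OF comp_mem[OF f[unfolded HomS] g[unfolded HomS]]] pc[OF f[unfolded HomS]]
        pc[OF g[unfolded HomS]] comp[OF f[unfolded HomS]]
      unfolding CompS card_atLeastAtMost diff_zero by (simp only: CompD)
  qed
qed

text \<open>Canonicity in (ii) is rendered by uniqueness of the isomorphism. In (b) and (c) one and
  the same P serves for the range and for the corner.\<close>

theorem proposition3p7:
  shows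
    \<comment> \<open>(i)\<close>
    "(\<forall>E :: (bsf, 'e) module. semimodule BB E \<longrightarrow>
        (selective E \<and> carrier E \<noteq> {\<zero>\<^bsub>E\<^esub>} \<longleftrightarrow> free_rk BB E = 1)) \<and>
    \<comment> \<open>(ii)\<close>
     (\<forall>n\<ge>1. semimodule BB (Bn1 n) \<and> rk BB (Bn1 n) = enat n \<and> free_rk BB (Bn1 n) = 1 \<and>
        (\<forall>E :: (bsf, 'e) module. semimodule BB E \<and> rk BB E = enat n \<and> free_rk BB E = 1 \<longrightarrow>
           (\<exists>!\<phi>. \<phi> \<in> linear_isos BB E (Bn1 n)))) \<and>
    \<comment> \<open>(iii) (a)\<close>
     (\<forall>n\<ge>1. \<forall>E :: (bsf, 'e) module. semimodule BB E \<and> rk BB E = enat n \<longrightarrow>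
        carrier (Bn1 n) \<lesssim> carrier E) \<and>
    \<comment> \<open>(iii) (b), (c)\<close>
     (\<forall>n\<ge>1. projective_semimodule TYPE('m) TYPE('n) BB (Bn1 n) \<and>
        (\<exists>P \<in> carrier_mat n n. P * P = P \<and>
           linear_isos BB (Bn1 n) (mat_range n P) \<noteq> {} \<and>
           semiring (End_semiring BB (Bn1 n)) \<and> semiring (corner_semiring n P) \<and>
           End_semiring BB (Bn1 n) \<simeq> corner_semiring n P)) \<and>
    \<comment> \<open>(iv)\<close>
     category (proj_category BB :: ((bsf, nat option) module, _) cat) \<and>
     Bn1 ` {1..} \<subseteq> Obj (proj_category BB) \<and>
     (\<forall>E \<in> Bn1 ` {1..}. \<forall>F \<in> Bn1 ` {1..}.
        Hom (proj_category BB) E F =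
          projective_class BB E F ` {f \<in> linear_maps BB E F. zero_kernel E F f}) \<and>
     category_iso simplicial_category (full_subcategory (proj_category BB) (Bn1 ` {1..}))
       (\<lambda>X. Bn1 (card X))
       (\<lambda>X Y f. projective_class BB (Bn1 (card X)) (Bn1 (card Y)) (extend_zero X f))"
proof (intro conjI allI impI category_proj_category_BB simplicial_category_iso)
  fix E :: "(bsf, 'e) module" assume "semimodule BB E"
  then show "selective E \<and> carrier E \<noteq> {\<zero>\<^bsub>E\<^esub>} \<longleftrightarrow> free_rk BB E = 1"
    by (simp only: semimodule_BB_iff bool_semimodule.selective_iff_free_rk)
next
  fix n :: nat
  show "semimodule BB (Bn1 n)" by (simp add: semimodule_BB_iff bool_semimodule_Bn1)
  show "rk BB (Bn1 n) = enat n" by (rule rk_Bn1)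
  show "projective_semimodule TYPE('m) TYPE('n) BB (Bn1 n)" by (rule projective_Bn1)
  assume n: "1 \<le> n"
  show "free_rk BB (Bn1 n) = 1" using n by (rule free_rk_Bn1)
  show "\<exists>P\<in>carrier_mat n n. P * P = P \<and> linear_isos BB (Bn1 n) (mat_range n P) \<noteq> {} \<and>
      semiring (End_semiring BB (Bn1 n)) \<and> semiring (corner_semiring n P) \<and>
      End_semiring BB (Bn1 n) \<simeq> corner_semiring n P"
    using chain_proj_idem mat_range_iso End_iso_corner
    by (intro bexI[of _ "chain_proj n"] conjI semiring_End semiring_corner bool_semimodule_Bn1) auto
next
  fix n :: nat and E :: "(bsf, 'e) module"
  assume "semimodule BB E \<and> rk BB E = enat n \<and> free_rk BB E = 1"
  then show "\<exists>!\<phi>. \<phi> \<in> linear_isos BB E (Bn1 n)"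
    by (intro unique_linear_iso_Bn1) (simp_all add: semimodule_BB_iff)
next
  fix n :: nat and E :: "(bsf, 'e) module"
  assume "semimodule BB E \<and> rk BB E = enat n"
  then have "{..n} \<lesssim> carrier E"
    by (intro bool_semimodule.carrier_lepoll_of_rk) (simp_all add: semimodule_BB_iff)
  moreover have "carrier (Bn1 n) \<lesssim> {..n}"
    by (rule lepoll_trans1[OF _ lepoll_refl])
      (auto simp: eqpoll_iff_card carrier_Bn1 card_image card_insert_if)
  ultimately show "carrier (Bn1 n) \<lesssim> carrier E" by (rule lepoll_trans[rotated])
next
  show "Bn1 ` {1..} \<subseteq> Obj (proj_category BB)"
    by (auto simp: proj_category_def semimodule_BB_iff bool_semimodule_Bn1)
  show "\<forall>E \<in> Bn1 ` {1..}. \<forall>F \<in> Bn1 ` {1..}. Hom (proj_category BB) E F =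
      projective_class BB E F ` {f \<in> linear_maps BB E F. zero_kernel E F f}"
    by (simp add: proj_category_def semilinear_maps_BB)
qed

end
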